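(* (1) Assume $\mathrm{cov}(\mathscr{M})=\mathfrak{c}$. Then there are $2^{\mathfrak{c}}$ pairwise Tukey incomparable selective ultrafilters on $\omega$. (2) Assume $\mathfrak{d}=\mathfrak{u}=\mathfrak{c}$. Then there are $2^{\mathfrak{c}}$ pairwise Tukey incomparable p-points on $\omega$.
   Context: $\mathrm{cov}(\mathscr{M})$ is the covering number of the meager ideal, $\mathfrak{d}$ the dominating number, $\mathfrak{u}$ the ultrafilter number, $\mathfrak{c}=2^{\aleph_0}$. Ultrafilters $\mathcal{U},\mathcal{V}$ are Tukey incomparable if neither $(\mathcal{U},\supseteq)\le_T(\mathcal{V},\supseteq)$ nor $(\mathcal{V},\supseteq)\le_T(\mathcal{U},\supseteq)$, where $D\le_T E$ means there is a map $E\to D$ sending cofinal subsets to cofinal subsets. Selective: for every $f:\omega\to\omega$ there is $X\in\mathcal{U}$ with $f\restriction X$ constant or one-to-one. p-point: a nonprincipal ultrafilter in which every countable subfamily $\{X_n\}$ has some $X$ in the ultrafilter with $X\setminus X_n$ finite for all $n$. *)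

theory Defs
  imports "HOL-Analysis.Analysis"
begin

unbundle cardinal_syntax

section \<open>Cardinal characteristics of the continuum\<close>

text \<open>
  Cardinals are cardinal well-orders, compared up to \<open>=o\<close>. The least cardinality of a member
  of a family of sets exists by well-foundedness as soon as the family is nonempty
  (lemma \<open>least_card_attained\<close>); it is only used for such families.
\<close>

definition least_card :: "'a set set \<Rightarrow> 'a rel" where
  "least_card \<A> = (SOME r. \<exists>A\<in>\<A>. r = |A| \<and> (\<forall>B\<in>\<A>. |A| \<le>o |B| ))"

lemma least_card_attained:
  assumes "\<A> \<noteq> {}"
  shows "\<exists>A\<in>\<A>. least_card \<A> = |A| \<and> (\<forall>B\<in>\<A>. |A| \<le>o |B| )"
proof -
  have "\<exists>r \<in> card_of ` \<A>. \<forall>r' \<in> card_of ` \<A>. r \<le>o r'"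
    using assms by (intro exists_minim_Card_order) (auto simp: card_of_Card_order)
  then have "\<exists>r. \<exists>A\<in>\<A>. r = |A| \<and> (\<forall>B\<in>\<A>. |A| \<le>o |B| )"
    by auto
  then show ?thesis
    unfolding least_card_def by (rule someI_ex)
qed

definition continuum :: "(nat \<Rightarrow> bool) rel" where
  "continuum = ctwo ^c natLeq"

definition nowhere_dense :: "'a::topological_space set \<Rightarrow> bool" where
  "nowhere_dense A \<longleftrightarrow> interior (closure A) = {}"

definition meager :: "'a::topological_space set \<Rightarrow> bool" where
  "meager A \<longleftrightarrow> (\<exists>\<N>. countable \<N> \<and> (\<forall>N\<in>\<N>. nowhere_dense N) \<and> A = \<Union>\<N>)"

text \<open>
  The meager ideal is that of the Baire space \<open>\<omega>\<^sup>\<omega>\<close>: the topology on \<^typ>\<open>nat \<Rightarrow> nat\<close> is the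
  product of the discrete topologies. Any other perfect Polish space gives the same cardinal.
\<close>

definition cov_meager :: "(nat \<Rightarrow> nat) set rel" where
  "cov_meager = least_card {\<C>. (\<forall>M\<in>\<C>. meager M) \<and> \<Union>\<C> = UNIV}"

definition dominating :: "(nat \<Rightarrow> nat) set \<Rightarrow> bool" where
  "dominating D \<longleftrightarrow> (\<forall>f. \<exists>g\<in>D. \<forall>\<^sub>F n in sequentially. f n \<le> g n)"

definition dominating_number :: "(nat \<Rightarrow> nat) rel" where
  "dominating_number = least_card {D. dominating D}"


section \<open>Ultrafilters on the natural numbers\<close>

definition filter_sets :: "'a filter \<Rightarrow> 'a set set" where
  "filter_sets F = {X. \<forall>\<^sub>F x in F. x \<in> X}"

definition nonprincipal_ultrafilter :: "nat filter \<Rightarrow> bool" where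
  "nonprincipal_ultrafilter U \<longleftrightarrow>
     U \<noteq> bot \<and> (\<forall>X. X \<in> filter_sets U \<or> - X \<in> filter_sets U) \<and> (\<forall>n. U \<noteq> principal {n})"

definition filter_base :: "'a set set \<Rightarrow> 'a filter \<Rightarrow> bool" where
  "filter_base \<B> F \<longleftrightarrow> \<B> \<subseteq> filter_sets F \<and> (\<forall>X\<in>filter_sets F. \<exists>B\<in>\<B>. B \<subseteq> X)"

definition ultrafilter_number :: "nat set rel" where
  "ultrafilter_number = least_card {\<B>. \<exists>U. nonprincipal_ultrafilter U \<and> filter_base \<B> U}"

definition selective_ultrafilter :: "nat filter \<Rightarrow> bool" where
  "selective_ultrafilter U \<longleftrightarrow> nonprincipal_ultrafilter U \<and>
     (\<forall>f :: nat \<Rightarrow> nat. \<exists>X\<in>filter_sets U. f constant_on X \<or> inj_on f X)"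

definition p_point :: "nat filter \<Rightarrow> bool" where
  "p_point U \<longleftrightarrow> nonprincipal_ultrafilter U \<and>
     (\<forall>\<X>. \<X> \<subseteq> filter_sets U \<and> countable \<X> \<longrightarrow>
        (\<exists>X\<in>filter_sets U. \<forall>Y\<in>\<X>. finite (X - Y)))"


section \<open>Tukey reducibility\<close>

text \<open>
  The library's \<^const>\<open>cofinal\<close> demands strict upper bounds and so excludes greatest elements;
  the notion needed here is the non-strict one.
\<close>

definition cofinal_subset :: "'a set \<Rightarrow> ('a \<Rightarrow> 'a \<Rightarrow> bool) \<Rightarrow> 'a set \<Rightarrow> bool" where
  "cofinal_subset D le C \<longleftrightarrow> C \<subseteq> D \<and> (\<forall>d\<in>D. \<exists>c\<in>C. le d c)"

definition tukey_le ::
    "'a set \<Rightarrow> ('a \<Rightarrow> 'a \<Rightarrow> bool) \<Rightarrow> 'b set \<Rightarrow> ('b \<Rightarrow> 'b \<Rightarrow> bool) \<Rightarrow> bool" where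
  "tukey_le D leD E leE \<longleftrightarrow>
     (\<exists>\<phi>. \<phi> ` E \<subseteq> D \<and> (\<forall>C. cofinal_subset E leE C \<longrightarrow> cofinal_subset D leD (\<phi> ` C)))"

definition tukey_incomparable :: "nat filter \<Rightarrow> nat filter \<Rightarrow> bool" where
  "tukey_incomparable U V \<longleftrightarrow>
     \<not> tukey_le (filter_sets U) (\<supseteq>) (filter_sets V) (\<supseteq>) \<and>
     \<not> tukey_le (filter_sets V) (\<supseteq>) (filter_sets U) (\<supseteq>)"

end

theory Submission
  imports Defs
begin

text \<open>
  If \<open>V\<close> is a p-point and \<open>U\<close> is Tukey below \<open>V\<close>, then this is witnessed by a continuous monotone
  map \<open>f\<close>, and \<open>f\<close> and \<open>V\<close> determine \<open>U\<close>; so at most continuum many ultrafilters lie below a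
  p-point. Let \<open>\<kappa>\<close> be the continuum. Call a free filter small if it is generated by fewer than \<open>\<kappa>\<close> sets. Under either
  hypothesis small filters are not ultrafilters, and one more generator suffices to meet any single
  requirement: to make a given function constant or one-to-one (finite-to-one) on a set of the filter,
  or to prevent a given \<open>f\<close> from reducing a given \<open>U\<close> to any ultrafilter extending the filter.
  A binary tree of height \<open>\<kappa>\<close> thus yields \<open>2\<^sup>\<kappa>\<close> ultrafilters of the desired kind, none of them
  above any of continuum many prescribed ultrafilters.

  If \<open>2\<^sup>\<kappa> = \<kappa>\<^sup>+\<close>, choose incomparable ultrafilters one after another by recursion of length
  \<open>\<kappa>\<^sup>+\<close>. Otherwise \<open>\<kappa>\<^sup>+ < 2\<^sup>\<kappa>\<close>, and Hajnal's free set theorem, applied to the map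
  sending an ultrafilter to the set of those below it, gives an antichain of full size.
\<close>

section \<open>Cardinal preliminaries\<close>

lemma continuum_eq: "continuum = |UNIV::(nat \<Rightarrow> bool) set|"
  by (simp add: continuum_def cexp_def ctwo_def Field_natLeq Func_def Field_card_of)

lemma ctwo_cexp_continuum: "ctwo ^c continuum = |UNIV::((nat \<Rightarrow> bool) \<Rightarrow> bool) set|"
  by (simp add: continuum_eq cexp_def ctwo_def Func_def Field_card_of)

lemma Field_continuum: "Field continuum = UNIV"
  by (simp add: continuum_eq Field_card_of)

lemma Card_order_continuum: "Card_order continuum"
  by (simp add: continuum_eq card_of_Card_order)

lemma natLeq_ordLess_continuum: "natLeq <o continuum"
  unfolding continuum_def by (rule ordLess_ctwo_cexp[OF natLeq_Card_order])

lemma Cinfinite_continuum: "Cinfinite continuum"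
  using cinfinite_mono[OF ordLess_imp_ordLeq[OF natLeq_ordLess_continuum] natLeq_cinfinite]
    Card_order_continuum by blast

lemma continuum_ordLess: "continuum <o |UNIV::((nat \<Rightarrow> bool) \<Rightarrow> bool) set|"
  using ordLess_ctwo_cexp[OF Card_order_continuum] by (simp add: ctwo_cexp_continuum)

lemma card_countable_continuum:
  assumes "countable A" shows "|A| <o continuum"
proof -
  have "|A| \<le>o |UNIV::nat set|"
    using assms by (auto simp: countable_def card_of_ordLeq[symmetric])
  then show ?thesis
    by (metis card_of_nat natLeq_ordLess_continuum ordIso_ordLess_trans ordLeq_ordLess_trans)
qed

lemma card_nat_set: "|A::nat set set| \<le>o continuum"
proof -
  have "inj_on (\<lambda>X n. n \<in> X) A"
    by (auto simp: inj_on_def fun_eq_iff)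
  then show ?thesis
    unfolding continuum_eq by (intro card_of_ordLeqI) auto
qed

text \<open>Serves to count continuous monotone maps and functions on the naturals, both of which
  are coded by subsets of a countable set.\<close>

lemma card_of_countable_subsets:
  fixes code :: "'a \<Rightarrow> 'b::countable set"
  assumes "inj_on code A"
  shows "|A| \<le>o continuum"
proof -
  have "inj_on (\<lambda>a. to_nat ` code a) A"
    using assms by (auto simp: inj_on_def inj_image_eq_iff)
  then have "|A| \<le>o |UNIV :: nat set set|"
    by (intro card_of_ordLeqI) auto
  then show ?thesis
    using card_nat_set ordLeq_transitive by blast
qed

lemma card_of_image_continuum: "|A| \<le>o continuum \<Longrightarrow> |f ` A| \<le>o continuum"
  using card_of_image ordLeq_transitive by blast

section \<open>Filters generated by fewer than continuum many sets\<close>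

text \<open>In the order of filters smaller means having more sets, so
  \<open>F \<le> cofinite\<close> says that all cofinite sets belong to \<open>F\<close>;
  ultrafilters extending \<open>F\<close> are then nonprincipal.\<close>

definition small_filter :: "nat filter \<Rightarrow> bool" where
  "small_filter F \<longleftrightarrow> F \<noteq> bot \<and> F \<le> cofinite \<and> (\<exists>\<B>. filter_base \<B> F \<and> |\<B>| <o continuum)"

text \<open>\<open>\<exists>\<^sub>F\<close> expresses positivity: the complement of
  \<open>X\<close> is not in \<open>F\<close>. Testing it on a base reduces later extension problems
  to meeting fewer than continuum many sets.\<close>

lemma frequently_filter_base:
  assumes "filter_base \<B> F"
  shows "(\<exists>\<^sub>F x in F. x \<in> X) \<longleftrightarrow> (\<forall>A\<in>\<B>. A \<inter> X \<noteq> {})"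
proof
  assume X: "\<exists>\<^sub>F x in F. x \<in> X"
  show "\<forall>A\<in>\<B>. A \<inter> X \<noteq> {}"
  proof
    fix A assume "A \<in> \<B>"
    then have "\<forall>\<^sub>F x in F. x \<in> A" using assms by (auto simp: filter_base_def filter_sets_def)
    with X have "\<exists>\<^sub>F x in F. x \<in> A \<and> x \<in> X" by (rule frequently_eventually_conj)
    then show "A \<inter> X \<noteq> {}" by (auto dest: frequently_ex)
  qed
next
  assume X: "\<forall>A\<in>\<B>. A \<inter> X \<noteq> {}"
  show "\<exists>\<^sub>F x in F. x \<in> X"
    unfolding frequently_def
  proof
    assume "\<forall>\<^sub>F x in F. x \<notin> X"
    then have "-X \<in> filter_sets F" by (simp add: filter_sets_def)
    then obtain A where "A \<in> \<B>" "A \<subseteq> -X" using assms by (auto simp: filter_base_def)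
    then show False using X by auto
  qed
qed

lemma inf_principal_neq_bot: "inf F (principal X) \<noteq> bot \<longleftrightarrow> (\<exists>\<^sub>F x in F. x \<in> X)"
  by (auto simp: trivial_limit_def eventually_inf_principal frequently_def)

text \<open>Intersecting every base set with \<open>X\<close> gives a base that is no larger. This
  is the single extension step of the tree.\<close>

lemma small_filter_inf:
  assumes "small_filter F" "\<exists>\<^sub>F x in F. x \<in> X"
  shows "small_filter (inf F (principal X))"
proof -
  obtain \<B> where \<B>: "filter_base \<B> F" "|\<B>| <o continuum"
    using assms by (auto simp: small_filter_def)
  have "filter_base ((\<lambda>A. A \<inter> X) ` \<B>) (inf F (principal X))"
    unfolding filter_base_def
  proof (intro conjI ballI subsetI)
    fix Y assume "Y \<in> (\<lambda>A. A \<inter> X) ` \<B>"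
    then show "Y \<in> filter_sets (inf F (principal X))"
      using \<B> by (auto simp: filter_base_def filter_sets_def eventually_inf_principal elim: eventually_mono)
  next
    fix Y assume "Y \<in> filter_sets (inf F (principal X))"
    then have "{x. x \<in> X \<longrightarrow> x \<in> Y} \<in> filter_sets F"
      by (simp add: filter_sets_def eventually_inf_principal)
    then obtain A where "A \<in> \<B>" "A \<subseteq> {x. x \<in> X \<longrightarrow> x \<in> Y}"
      using \<B> unfolding filter_base_def by blast
    then show "\<exists>B\<in>(\<lambda>A. A \<inter> X) ` \<B>. B \<subseteq> Y" by auto
  qed
  moreover have "|(\<lambda>A. A \<inter> X) ` \<B>| <o continuum"
    using card_of_image \<B>(2) ordLeq_ordLess_trans by blast
  moreover have "inf F (principal X) \<le> cofinite"
    using assms(1) by (auto simp: small_filter_def intro: le_infI1)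
  ultimately show ?thesis
    using assms(2) unfolding small_filter_def inf_principal_neq_bot by blast
qed

text \<open>The images of the base sets form a base. The lemma allows the filter of block numbers to
  be split in place of \<open>F\<close>.\<close>

lemma small_filter_filtermap:
  assumes "small_filter F" "filtermap p F \<le> cofinite"
  shows "small_filter (filtermap p F)"
proof -
  obtain \<B> where \<B>: "filter_base \<B> F" "|\<B>| <o continuum"
    using assms by (auto simp: small_filter_def)
  have "filter_base ((`) p ` \<B>) (filtermap p F)"
    unfolding filter_base_def
  proof (intro conjI ballI subsetI)
    fix Y assume "Y \<in> (`) p ` \<B>"
    then show "Y \<in> filter_sets (filtermap p F)"
      using \<B> by (auto simp: filter_base_def filter_sets_def eventually_filtermap elim!: eventually_mono)
  next
    fix Y assume "Y \<in> filter_sets (filtermap p F)"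
    then have "p -` Y \<in> filter_sets F"
      by (simp add: filter_sets_def eventually_filtermap)
    then obtain A where "A \<in> \<B>" "A \<subseteq> p -` Y"
      using \<B> unfolding filter_base_def by blast
    then show "\<exists>B\<in>(`) p ` \<B>. B \<subseteq> Y" by auto
  qed
  moreover have "|(`) p ` \<B>| <o continuum"
    using card_of_image \<B>(2) ordLeq_ordLess_trans by blast
  ultimately show ?thesis
    using assms unfolding small_filter_def by (auto simp: filtermap_bot_iff)
qed

lemma frequently_infinite:
  assumes "F \<le> cofinite" "\<exists>\<^sub>F x in F. x \<in> X" shows "infinite X"
proof
  assume "finite X"
  then have "\<forall>\<^sub>F x in cofinite. x \<notin> X" by (simp add: eventually_cofinite)
  with assms(1) have "\<forall>\<^sub>F x in F. x \<notin> X" by (rule filter_leD)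
  with assms(2) show False by (simp add: frequently_def)
qed

lemma frequently_inf_principal:
  "(\<exists>\<^sub>F x in inf F (principal X). P x) \<longleftrightarrow> (\<exists>\<^sub>F x in F. x \<in> X \<and> P x)"
  by (simp add: frequently_def eventually_inf_principal)

section \<open>Nonprincipal ultrafilters\<close>

lemma nonprincipal_ultrafilterI:
  assumes "U \<noteq> bot" "U \<le> cofinite" "\<And>X. (\<forall>\<^sub>F x in U. x \<in> X) \<or> (\<forall>\<^sub>F x in U. x \<notin> X)"
  shows "nonprincipal_ultrafilter U"
proof -
  have "U \<noteq> principal {n}" for n
  proof
    assume U: "U = principal {n}"
    have "\<forall>\<^sub>F x in U. x \<noteq> n"
      using assms(2) by (rule filter_leD) (simp add: eventually_cofinite)
    with U assms(1) show False by (simp add: eventually_principal)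
  qed
  with assms show ?thesis
    by (auto simp: nonprincipal_ultrafilter_def filter_sets_def)
qed

text \<open>An ultrafilter containing a singleton is principal, so all complements of singletons,
  and hence of finite sets, lie in \<open>U\<close>.\<close>

lemma nonprincipal_ultrafilter_cofinite:
  assumes "nonprincipal_ultrafilter U" shows "U \<le> cofinite"
proof -
  have *: "\<forall>\<^sub>F x in U. x \<noteq> n" for n
  proof (rule ccontr)
    assume "\<not> (\<forall>\<^sub>F x in U. x \<noteq> n)"
    then have n: "\<forall>\<^sub>F x in U. x = n"
      using assms[unfolded nonprincipal_ultrafilter_def, THEN conjunct2, THEN conjunct1,
          THEN spec[of _ "{n}"]]
      by (simp add: filter_sets_def)
    have "principal {n} \<le> U"
    proof (rule filter_leI)
      fix P assume P: "eventually P U"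
      have "P n"
      proof (rule ccontr)
        assume "\<not> P n"
        with P n have "\<forall>\<^sub>F x in U. False" by (auto elim: eventually_elim2)
        then show False using assms by (simp add: nonprincipal_ultrafilter_def trivial_limit_def)
      qed
      then show "eventually P (principal {n})" by (simp add: eventually_principal)
    qed
    moreover have "U \<le> principal {n}" using n by (simp add: le_principal)
    ultimately show False using assms by (auto simp: nonprincipal_ultrafilter_def)
  qed
  show ?thesis
  proof (rule filter_leI)
    fix P :: "nat \<Rightarrow> bool" assume "eventually P cofinite"
    then have "finite {x. \<not> P x}" by (simp add: eventually_cofinite)
    then have "\<forall>\<^sub>F x in U. \<forall>y\<in>{x. \<not> P x}. x \<noteq> y"
      using * by (intro eventually_ball_finite) auto
    then show "eventually P U" by (auto elim: eventually_mono)
  qed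
qed

lemma ultrafilter_Compl:
  assumes "nonprincipal_ultrafilter U"
  shows "-X \<in> filter_sets U \<longleftrightarrow> X \<notin> filter_sets U"
proof -
  have "X \<in> filter_sets U \<Longrightarrow> -X \<in> filter_sets U \<Longrightarrow> False"
    using assms eventually_conj[of "\<lambda>x. x \<in> X" U "\<lambda>x. x \<notin> X"]
    by (simp add: filter_sets_def nonprincipal_ultrafilter_def trivial_limit_def)
  then show ?thesis using assms by (auto simp: nonprincipal_ultrafilter_def)
qed

lemma filter_sets_Int: "X \<in> filter_sets U \<Longrightarrow> Y \<in> filter_sets U \<Longrightarrow> X \<inter> Y \<in> filter_sets U"
  by (simp add: filter_sets_def eventually_conj)

lemma filter_sets_mono: "X \<in> filter_sets U \<Longrightarrow> X \<subseteq> Y \<Longrightarrow> Y \<in> filter_sets U"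
  by (auto simp: filter_sets_def elim: eventually_mono)

lemma filter_sets_finite_diff:
  assumes "U \<le> cofinite" "X \<in> filter_sets U" "finite J" shows "X - J \<in> filter_sets U"
proof -
  have "-J \<in> filter_sets U"
    unfolding filter_sets_def mem_Collect_eq using assms(1)
    by (rule filter_leD) (use assms(3) in \<open>simp add: eventually_cofinite\<close>)
  then show ?thesis using assms(2) filter_sets_Int by (metis Diff_eq)
qed

lemma filter_sets_inj: "filter_sets U = filter_sets V \<Longrightarrow> U = V"
  unfolding filter_eq_iff
proof
  fix P assume "filter_sets U = filter_sets V"
  then have "{x. P x} \<in> filter_sets U \<longleftrightarrow> {x. P x} \<in> filter_sets V" by simp
  then show "eventually P U \<longleftrightarrow> eventually P V" by (simp add: filter_sets_def)
qed

lemma ultrafilter_infinite: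
  assumes "nonprincipal_ultrafilter U" "X \<in> filter_sets U" shows "infinite X"
proof
  assume "finite X"
  then have "{} \<in> filter_sets U"
    using filter_sets_finite_diff[OF nonprincipal_ultrafilter_cofinite[OF assms(1)] assms(2)] by force
  then show False using assms(1) by (simp add: filter_sets_def nonprincipal_ultrafilter_def trivial_limit_def)
qed

lemma frequently_coarser_ultrafilter:
  assumes "nonprincipal_ultrafilter V" "V \<le> F" "X \<in> filter_sets V"
  shows "\<exists>\<^sub>F x in F. x \<in> X"
  unfolding frequently_def
proof
  assume "\<forall>\<^sub>F x in F. x \<notin> X"
  with assms(2) have "\<forall>\<^sub>F x in V. x \<notin> X" by (rule filter_leD)
  then have "-X \<in> filter_sets V" by (simp add: filter_sets_def)
  with assms show False by (simp add: ultrafilter_Compl)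
qed

section \<open>Continuous monotone maps\<close>

text \<open>The second clause is continuity on the Cantor space of subsets: by compactness each
  output bit depends on a bounded part of the input, with a bound uniform in
  \<open>X\<close>.\<close>

definition monotone_continuous :: "(nat set \<Rightarrow> nat set) \<Rightarrow> bool" where
  "monotone_continuous f \<longleftrightarrow> mono f \<and> (\<forall>k. \<exists>m. \<forall>X. k \<in> f X \<longleftrightarrow> k \<in> f (X \<inter> {..<m}))"

text \<open>The images of the members of \<open>V\<close> form a filter base of \<open>U\<close>,
  which is why \<open>f\<close> and \<open>V\<close> determine \<open>U\<close>.\<close>

definition cofinal_map :: "(nat set \<Rightarrow> nat set) \<Rightarrow> nat filter \<Rightarrow> nat filter \<Rightarrow> bool" where
  "cofinal_map f V U \<longleftrightarrow> (\<forall>X\<in>filter_sets V. f X \<in> filter_sets U) \<and>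
     (\<forall>Y\<in>filter_sets U. \<exists>X\<in>filter_sets V. f X \<subseteq> Y)"

lemma cofinal_map_determines:
  assumes "cofinal_map f V U" "cofinal_map f V U'" shows "U = U'"
proof -
  have "filter_sets W = {Y. \<exists>X\<in>filter_sets V. f X \<subseteq> Y}" if "cofinal_map f V W" for W
    using that filter_sets_mono unfolding cofinal_map_def by blast
  then show ?thesis using assms filter_sets_inj by metis
qed

text \<open>Continuity lets the values on finite sets determine \<open>f\<close>, and
  \<open>set_decode\<close> enumerates the finite sets.\<close>

lemma card_monotone_continuous: "|Collect monotone_continuous| \<le>o continuum"
proof -
  let ?code = "\<lambda>f. {(n, k). k \<in> f (set_decode n)}"
  have "inj_on ?code (Collect monotone_continuous)"
  proof (rule inj_onI, rule ext, rule set_eqI)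
    fix f g X k
    assume f: "f \<in> Collect monotone_continuous" and g: "g \<in> Collect monotone_continuous"
      and eq: "?code f = ?code g"
    obtain m where m: "\<And>X. k \<in> f X \<longleftrightarrow> k \<in> f (X \<inter> {..<m})"
      using f unfolding monotone_continuous_def by blast
    obtain n where n: "\<And>X. k \<in> g X \<longleftrightarrow> k \<in> g (X \<inter> {..<n})"
      using g unfolding monotone_continuous_def by blast
    let ?Y = "X \<inter> {..<max m n}"
    have "finite ?Y" by simp
    have "(set_encode ?Y, k) \<in> ?code f \<longleftrightarrow> (set_encode ?Y, k) \<in> ?code g"
      using eq by simp
    then have Y: "k \<in> f ?Y \<longleftrightarrow> k \<in> g ?Y"
      using \<open>finite ?Y\<close> by simp
    have "?Y \<inter> {..<m} = X \<inter> {..<m}" "?Y \<inter> {..<n} = X \<inter> {..<n}" by auto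
    then show "k \<in> f X \<longleftrightarrow> k \<in> g X"
      using Y m[of X] m[of ?Y] n[of X] n[of ?Y] by simp
  qed
  then show ?thesis by (rule card_of_countable_subsets)
qed

section \<open>Sparse block partitions and avoidance of cofinal maps\<close>

text \<open>Distinct points are chosen recursively, those numbered \<open>2 * n\<close> and
  \<open>2 * n + 1\<close> from \<open>A n\<close>; the even-numbered points form \<open>Z\<close>,
  the odd-numbered ones stay outside.\<close>

lemma splitting_set:
  fixes A :: "nat \<Rightarrow> 'a set"
  assumes "\<And>n. infinite (A n)"
  shows "\<exists>Z. \<forall>n. A n \<inter> Z \<noteq> {} \<and> A n - Z \<noteq> {}"
proof -
  have "\<exists>s. \<forall>n. s n \<in> A (n div 2) \<and> s n \<notin> s ` {..<n}"
  proof (rule dependent_wellorder_choice)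
    fix r :: 'a and f g :: "nat \<Rightarrow> 'a" and n :: nat
    assume "\<And>y. y < n \<Longrightarrow> f y = g y"
    then have "f ` {..<n} = g ` {..<n}" by (intro image_cong) auto
    then show "(r \<in> A (n div 2) \<and> r \<notin> f ` {..<n}) = (r \<in> A (n div 2) \<and> r \<notin> g ` {..<n})"
      by simp
  next
    fix n :: nat and s :: "nat \<Rightarrow> 'a"
    have "infinite (A (n div 2) - s ` {..<n})" using assms by (simp add: Diff_infinite_finite)
    then show "\<exists>r. r \<in> A (n div 2) \<and> r \<notin> s ` {..<n}"
      using infinite_imp_nonempty by blast
  qed
  then obtain s where s: "\<And>n. s n \<in> A (n div 2)" "\<And>n. s n \<notin> s ` {..<n}" by blast
  have inj: "inj s"
  proof (rule linorder_injI)
    fix i j :: nat assume "i < j"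
    then have "s i \<in> s ` {..<j}" by simp
    then show "s i \<noteq> s j" using s(2)[of j] by metis
  qed
  let ?Z = "range (\<lambda>n. s (2 * n))"
  have "s (2 * n) \<in> A n \<inter> ?Z" for n using s(1)[of "2 * n"] by simp
  moreover have "s (2 * n + 1) \<in> A n - ?Z" for n
  proof -
    have "s (2 * n + 1) \<noteq> s (2 * k)" for k
      unfolding inj_eq[OF inj] by presburger
    then show ?thesis using s(1)[of "2 * n + 1"] by auto
  qed
  ultimately show ?thesis by blast
qed

text \<open>Iterating \<open>b\<close> from 0 yields the endpoints \<open>a i\<close> of consecutive
  intervals, and \<open>p x\<close> is the number of the interval containing \<open>x\<close>:
  \<open>p x = i\<close> means \<open>a i \<le> x < a (Suc i)\<close>.\<close>

lemma block_partition:
  fixes b :: "nat \<Rightarrow> nat"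
  assumes b: "\<And>n. n < b n"
  obtains a p where "\<And>i. a (Suc i) = b (a i)" "\<And>x i. p x < i \<longleftrightarrow> x < (a i :: nat)"
proof -
  define a where "a i = (b ^^ i) 0" for i
  have aS: "a (Suc i) = b (a i)" for i by (simp add: a_def)
  have sa: "strict_mono a" by (simp add: strict_mono_Suc_iff aS b)
  define p where "p x = (LEAST i. x < a (Suc i))" for x
  have p: "x < a (Suc (p x))" for x
    unfolding p_def
  proof (rule LeastI)
    show "x < a (Suc x)" using strict_mono_imp_increasing[OF sa, of "Suc x"] by simp
  qed
  have "p x < i \<longleftrightarrow> x < a i" for x i
  proof
    assume "p x < i"
    then show "x < a i"
      using less_le_trans[OF p[of x]] strict_mono_less_eq[OF sa, of "Suc (p x)" i] by simp
  next
    assume x: "x < a i"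
    then obtain j where j: "i = Suc j" by (cases i) (auto simp: a_def)
    then have "p x \<le> j" using x unfolding p_def by (intro Least_le) simp
    with j show "p x < i" by simp
  qed
  with aS show thesis by (rule that)
qed

text \<open>
  Either the values of \<open>f\<close> on finite subsets of the sets positive for \<open>F\<close> are already infinite,
  and then a set splitting these countably many values refutes cofinality; or, on a sufficiently
  sparse block partition, \<open>f\<close> moves points by at most one block, and two positive unions of blocks
  lying far apart have almost disjoint images, so that one of the images is not in \<open>U\<close>.
\<close>

lemma small_filter_avoid_cofinal_map:
  assumes split: "\<And>F. small_filter F \<Longrightarrow> \<exists>E. (\<exists>\<^sub>F x in F. x \<in> E) \<and> (\<exists>\<^sub>F x in F. x \<notin> E)"
    and F: "small_filter F" and f: "monotone_continuous f" and U: "nonprincipal_ultrafilter U"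
  shows "\<exists>X. (\<exists>\<^sub>F x in F. x \<in> X) \<and>
    (\<forall>V. nonprincipal_ultrafilter V \<and> V \<le> inf F (principal X) \<longrightarrow> \<not> cofinal_map f V U)"
proof (cases "\<forall>X. (\<exists>\<^sub>F x in F. x \<in> X) \<longrightarrow> (\<exists>g\<subseteq>X. finite g \<and> infinite (f g))")
  case True
  let ?G = "{g. finite g \<and> infinite (f g)}"
  have fmono: "\<And>X Y. X \<subseteq> Y \<Longrightarrow> f X \<subseteq> f Y"
    using f by (simp add: monotone_continuous_def mono_def)
  have top: "\<exists>\<^sub>F x in F. x \<in> UNIV"
    using F by (simp add: small_filter_def)
  have ne: "?G \<noteq> {}" using True top by blast
  have cG: "countable ?G"
    by (rule countable_subset[OF _ countable_Collect_finite]) auto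
  have "\<exists>Z. \<forall>n. f (from_nat_into ?G n) \<inter> Z \<noteq> {} \<and> f (from_nat_into ?G n) - Z \<noteq> {}"
    using from_nat_into[OF ne] by (intro splitting_set) auto
  then obtain Z where "\<And>n. f (from_nat_into ?G n) \<inter> Z \<noteq> {} \<and> f (from_nat_into ?G n) - Z \<noteq> {}"
    by blast
  then have Z: "f g \<inter> Z \<noteq> {} \<and> f g - Z \<noteq> {}" if "g \<in> ?G" for g
    using from_nat_into_surj[OF cG that] by auto
  have "\<not> cofinal_map f V U" if V: "nonprincipal_ultrafilter V" "V \<le> F" for V
  proof
    assume c: "cofinal_map f V U"
    have "Z \<in> filter_sets U \<or> -Z \<in> filter_sets U"
      using U by (simp add: nonprincipal_ultrafilter_def)
    then obtain X where X: "X \<in> filter_sets V" "f X \<subseteq> Z \<or> f X \<subseteq> -Z"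
      using c unfolding cofinal_map_def by blast
    obtain g where "g \<subseteq> X" "g \<in> ?G"
      using True frequently_coarser_ultrafilter[OF V X(1)] by blast
    with X(2) Z fmono show False by blast
  qed
  then show ?thesis using top by (intro exI[of _ UNIV]) auto
next
  case False
  then obtain X where X: "\<exists>\<^sub>F x in F. x \<in> X" and fin: "\<And>g. g \<subseteq> X \<Longrightarrow> finite g \<Longrightarrow> finite (f g)"
    by blast
  have fmono: "\<And>X Y. X \<subseteq> Y \<Longrightarrow> f X \<subseteq> f Y"
    using f by (simp add: monotone_continuous_def mono_def)
  have "\<exists>m. \<forall>k X. k \<in> f X \<longleftrightarrow> k \<in> f (X \<inter> {..<m k})"
    using f unfolding monotone_continuous_def by (intro choice) blast
  then obtain m where m: "\<And>k X. k \<in> f X \<longleftrightarrow> k \<in> f (X \<inter> {..<m k})" by blast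
  \<comment> \<open>The first bound says that membership of any \<open>k < n\<close> in
    \<open>f Y\<close> is decided below \<open>N\<close>; the second that the points of
    \<open>X\<close> below \<open>n\<close> alone produce only values below
    \<open>N\<close>.\<close>
  have "\<exists>N>n. (\<forall>k<n. m k \<le> N) \<and> f (X \<inter> {..<n}) \<subseteq> {..<N}" for n
  proof -
    have "finite (f (X \<inter> {..<n}) \<union> m ` {..<n} \<union> {n})" using fin by simp
    then obtain N where "f (X \<inter> {..<n}) \<union> m ` {..<n} \<union> {n} \<subseteq> {..<N}"
      using finite_nat_iff_bounded by blast
    then show ?thesis by (intro exI[of _ N]) auto
  qed
  then have "\<exists>b. \<forall>n. b n > n \<and> (\<forall>k<n. m k \<le> b n) \<and> f (X \<inter> {..<n}) \<subseteq> {..<b n}"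
    by (intro choice allI)
  then obtain b where b: "\<And>n. n < b n" "\<And>n k. k < n \<Longrightarrow> m k \<le> b n" "\<And>n. f (X \<inter> {..<n}) \<subseteq> {..<b n}"
    by blast
  obtain a p where a: "\<And>i. a (Suc i) = b (a i)" and p: "\<And>x i. p x < i \<longleftrightarrow> x < a i"
    using block_partition[OF b(1)] by blast
  \<comment> \<open>One residue class of block numbers modulo 3 is positive. Within it distinct
    blocks are at least three apart, whereas points responsible for a common value will be at most
    two blocks apart.\<close>
  have "\<exists>\<^sub>F x in F. \<exists>r\<in>{..<3::nat}. x \<in> X \<and> p x mod 3 = r"
    using X by (rule frequently_elim1) auto
  then obtain r where r: "\<exists>\<^sub>F x in F. x \<in> X \<and> p x mod 3 = r"
    using frequently_bex_finite[of "{..<3}" "\<lambda>x r. x \<in> X \<and> p x mod 3 = r" F] by blast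
  define P where "P = {x \<in> X. p x mod 3 = r}"
  have small: "small_filter (inf F (principal P))"
    using F r by (intro small_filter_inf) (auto simp: P_def)
  have "filtermap p (inf F (principal P)) \<le> cofinite"
  proof (rule filter_leI)
    fix Q assume "eventually Q (cofinite :: nat filter)"
    then have "finite {i. \<not> Q i}" by (simp add: eventually_cofinite)
    then have "finite (\<Union>i\<in>{i. \<not> Q i}. {..<a (Suc i)})" by simp
    moreover have "{x. \<not> Q (p x)} \<subseteq> (\<Union>i\<in>{i. \<not> Q i}. {..<a (Suc i)})"
      using p[of _ "Suc (p _)"] by auto
    ultimately have "eventually (\<lambda>x. Q (p x)) cofinite"
      unfolding eventually_cofinite by (rule rev_finite_subset)
    then show "eventually Q (filtermap p (inf F (principal P)))"
      using small filter_leD unfolding small_filter_def eventually_filtermap by blast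
  qed
  \<comment> \<open>Splitting the image under \<open>p\<close> instead of \<open>F\<close> itself
    keeps the points of \<open>P\<close> in one block together.\<close>
  from split[OF small_filter_filtermap[OF small this]]
  obtain E where E: "\<exists>\<^sub>F x in F. x \<in> P \<and> p x \<in> E" "\<exists>\<^sub>F x in F. x \<in> P \<and> p x \<notin> E"
    by (auto simp: frequently_filtermap frequently_inf_principal)
  \<comment> \<open>Otherwise the part of \<open>Y\<close> that decides \<open>k\<close> lies before
    block \<open>p k - 1\<close>, and its image stays before block \<open>p k\<close>. The condition
    \<open>a 1 \<le> k\<close> excludes block 0, which has no predecessor.\<close>
  have near: "\<exists>y\<in>Y. p k \<le> Suc (p y) \<and> p y \<le> Suc (p k)"
    if Y: "Y \<subseteq> P" "k \<in> f Y" "a 1 \<le> k" for Y k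
  proof (rule ccontr)
    assume no: "\<not> ?thesis"
    have "p k \<noteq> 0" using p[of k 1] that(3) by simp
    then obtain j where j: "p k = Suc j" by (cases "p k") auto
    have "m k \<le> a (Suc (Suc (p k)))" using b(2)[of k "a (Suc (p k))"] p[of k "Suc (p k)"] by (simp add: a)
    then have "Y \<inter> {..<m k} \<subseteq> Y \<inter> {..<a (Suc (Suc (p k)))}" by auto
    also have "\<dots> \<subseteq> X \<inter> {..<a j}"
    proof
      fix y assume y: "y \<in> Y \<inter> {..<a (Suc (Suc (p k)))}"
      then have "p y \<le> Suc (p k)" using p[of y "Suc (Suc (p k))"] by simp
      with no y have "Suc (p y) < p k" by force
      then have "p y < j" using j by simp
      with y Y(1) show "y \<in> X \<inter> {..<a j}" using p[of y j] by (auto simp: P_def)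
    qed
    finally have "f (Y \<inter> {..<m k}) \<subseteq> {..<a (Suc j)}"
      using order_trans[OF fmono b(3)] a by simp
    then have "k < a (p k)" using m[of k Y] Y(2) j by auto
    then show False using p[of k "p k"] by simp
  qed
  define Y0 where "Y0 = {x \<in> P. p x \<in> E}"
  define Y1 where "Y1 = {x \<in> P. p x \<notin> E}"
  have "f Y0 \<inter> f Y1 \<subseteq> {..<a 1}"
  proof (rule ccontr)
    assume "\<not> ?thesis"
    then obtain k where k: "k \<in> f Y0" "k \<in> f Y1" "a 1 \<le> k" by force
    obtain y where y: "y \<in> Y0" "p k \<le> Suc (p y)" "p y \<le> Suc (p k)"
      using near[of Y0 k] k by (auto simp: Y0_def)
    obtain z where z: "z \<in> Y1" "p k \<le> Suc (p z)" "p z \<le> Suc (p k)"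
      using near[of Y1 k] k by (auto simp: Y1_def)
    have "p y mod 3 = p z mod 3" using y z by (auto simp: Y0_def Y1_def P_def)
    moreover have "p y \<le> p z + 2" "p z \<le> p y + 2" using y z by auto
    ultimately have "p y = p z" by presburger
    with y z show False by (auto simp: Y0_def Y1_def)
  qed
  then have "finite (f Y0 \<inter> f Y1)" using finite_subset by blast
  then have "f Y0 \<notin> filter_sets U \<or> f Y1 \<notin> filter_sets U"
    using ultrafilter_infinite[OF U] filter_sets_Int by blast
  moreover have "\<exists>\<^sub>F x in F. x \<in> Y0" "\<exists>\<^sub>F x in F. x \<in> Y1"
    using E by (simp_all add: Y0_def Y1_def)
  ultimately obtain Y where Y: "\<exists>\<^sub>F x in F. x \<in> Y" "f Y \<notin> filter_sets U"
    by blast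
  have "\<not> cofinal_map f V U" if "V \<le> inf F (principal Y)" for V
    using Y(2) that by (auto simp: cofinal_map_def filter_sets_def le_principal)
  with Y(1) show ?thesis by blast
qed

section \<open>P-points\<close>

text \<open>If the intersection of the sets \<open>X n\<close> is not in \<open>V\<close>, map each
  \<open>k\<close> outside it to the first \<open>n\<close> with \<open>k \<notin> X n\<close>. On a
  set of \<open>V\<close> this map cannot be constant, as that set would miss some
  \<open>X n\<close>; and where it is finite-to-one, only finitely many points lie outside a given
  \<open>X n\<close>.\<close>

lemma p_pointI:
  assumes V: "nonprincipal_ultrafilter V"
    and ftt: "\<And>f :: nat \<Rightarrow> nat. \<exists>X\<in>filter_sets V. f constant_on X \<or> (\<forall>n. finite {x\<in>X. f x = n})"
  shows "p_point V"
  unfolding p_point_def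
proof (intro conjI V allI impI)
  fix \<X> assume \<X>: "\<X> \<subseteq> filter_sets V \<and> countable \<X>"
  show "\<exists>X\<in>filter_sets V. \<forall>Y\<in>\<X>. finite (X - Y)"
  proof (cases "\<Inter>\<X> \<in> filter_sets V")
    case True
    have "finite (\<Inter>\<X> - Y)" if "Y \<in> \<X>" for Y
    proof -
      have "\<Inter>\<X> - Y = {}" using that by blast
      then show ?thesis by (simp only: finite.emptyI)
    qed
    with True show ?thesis by blast
  next
    case False
    then have co: "- \<Inter>\<X> \<in> filter_sets V" using V by (simp add: ultrafilter_Compl)
    have "\<X> \<noteq> {}"
    proof
      assume "\<X> = {}"
      with False show False by (simp add: filter_sets_def)
    qed
    define X where "X = from_nat_into \<X>"
    have XV: "X n \<in> filter_sets V" for n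
      using from_nat_into[OF \<open>\<X> \<noteq> {}\<close>] \<X> by (auto simp: X_def)
    have Xsurj: "\<exists>n. Y = X n" if "Y \<in> \<X>" for Y
      using from_nat_into_surj[of \<X> Y] \<X> that by (simp add: X_def) (metis)
    define f where "f k = (LEAST n. k \<notin> X n)" for k
    obtain Y where Y: "Y \<in> filter_sets V" "f constant_on Y \<or> (\<forall>n. finite {x\<in>Y. f x = n})"
      using ftt by blast
    let ?Z = "Y \<inter> - \<Inter>\<X>"
    have Z: "?Z \<in> filter_sets V" using Y(1) co by (rule filter_sets_Int)
    have f: "k \<notin> X (f k)" if k: "k \<in> ?Z" for k
    proof -
      obtain W where "W \<in> \<X>" "k \<notin> W" using k by blast
      then obtain n where "k \<notin> X n" using Xsurj by blast
      then show ?thesis unfolding f_def by (rule LeastI)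
    qed
    have "\<not> f constant_on Y"
    proof
      assume "f constant_on Y"
      then obtain c where c: "\<And>k. k \<in> Y \<Longrightarrow> f k = c" by (auto simp: constant_on_def)
      have "k \<notin> X c" if "k \<in> ?Z" for k using f[OF that] c[of k] that by simp
      then have "?Z \<inter> X c = {}" by blast
      then show False
        using ultrafilter_infinite[OF V filter_sets_Int[OF Z XV[of c]]] by simp
    qed
    then have fin: "finite {x\<in>Y. f x = n}" for n using Y(2) by blast
    have "finite (?Z - X n)" for n
    proof (rule finite_subset)
      show "?Z - X n \<subseteq> (\<Union>i\<le>n. {x\<in>Y. f x = i})"
      proof
        fix x assume x: "x \<in> ?Z - X n"
        then have "f x \<le> n" unfolding f_def by (intro Least_le) simp
        with x show "x \<in> (\<Union>i\<le>n. {x\<in>Y. f x = i})" by blast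
      qed
      show "finite (\<Union>i\<le>n. {x\<in>Y. f x = i})" using fin by simp
    qed
    then have "finite (?Z - W)" if "W \<in> \<X>" for W using Xsurj[OF that] by auto
    then show ?thesis using Z by blast
  qed
qed

text \<open>For \<open>Y\<close> in \<open>U\<close> the sets \<open>X\<close> with
  \<open>\<phi> X\<close> not inside \<open>Y\<close> are not cofinal, since their images are not;
  so some \<open>W\<close> in \<open>V\<close> has all \<open>\<phi>\<close>-values of its subsets
  from \<open>V\<close> inside \<open>Y\<close>. Taking unions of these values over subsets makes
  the map monotone.\<close>

lemma tukey_le_monotone:
  assumes "tukey_le (filter_sets U) (\<supseteq>) (filter_sets V) (\<supseteq>)"
  shows "\<exists>\<psi>. mono \<psi> \<and> cofinal_map \<psi> V U"
proof -
  obtain \<phi> where \<phi>: "\<And>X. X \<in> filter_sets V \<Longrightarrow> \<phi> X \<in> filter_sets U"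
    and cof: "\<And>C. cofinal_subset (filter_sets V) (\<supseteq>) C \<Longrightarrow> cofinal_subset (filter_sets U) (\<supseteq>) (\<phi> ` C)"
    using assms unfolding tukey_le_def by blast
  have G: "\<exists>W\<in>filter_sets V. \<forall>X\<in>filter_sets V. X \<subseteq> W \<longrightarrow> \<phi> X \<subseteq> Y" if Y: "Y \<in> filter_sets U" for Y
  proof (rule ccontr)
    assume no: "\<not> ?thesis"
    have "cofinal_subset (filter_sets V) (\<supseteq>) {X \<in> filter_sets V. \<not> \<phi> X \<subseteq> Y}"
      unfolding cofinal_subset_def using no by blast
    from cof[OF this] Y show False unfolding cofinal_subset_def by blast
  qed
  define \<psi> where "\<psi> X = (\<Union>X'\<in>{X'\<in>filter_sets V. X' \<subseteq> X}. \<phi> X')" for X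
  have "mono \<psi>" unfolding mono_def \<psi>_def by blast
  moreover have "cofinal_map \<psi> V U"
    unfolding cofinal_map_def
  proof (intro conjI ballI)
    fix X assume X: "X \<in> filter_sets V"
    then show "\<psi> X \<in> filter_sets U"
      by (intro filter_sets_mono[OF \<phi>[OF X]]) (auto simp: \<psi>_def)
  next
    fix Y assume "Y \<in> filter_sets U"
    from G[OF this] show "\<exists>X\<in>filter_sets V. \<psi> X \<subseteq> Y" unfolding \<psi>_def by blast
  qed
  ultimately show ?thesis by blast
qed

text \<open>
  The predicate \<open>Q s k\<close> says that \<open>k\<close> is forced into \<open>\<psi> X\<close> by the finite part \<open>s\<close> of \<open>X\<close>. A
  pseudo-intersection of the countably many witnesses \<open>N s k\<close> against \<open>Q s k\<close>, thinned out to every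
  other block of a sufficiently sparse partition, makes membership in \<open>\<psi> X\<close> decided by finite parts.
\<close>

lemma p_point_tukey_le:
  assumes V: "p_point V" and UV: "tukey_le (filter_sets U) (\<supseteq>) (filter_sets V) (\<supseteq>)"
  shows "\<exists>f. monotone_continuous f \<and> cofinal_map f V U"
proof -
  have uV: "nonprincipal_ultrafilter V" using V by (simp add: p_point_def)
  obtain \<psi> where mono: "\<And>X Y. X \<subseteq> Y \<Longrightarrow> \<psi> X \<subseteq> \<psi> Y" and \<psi>: "cofinal_map \<psi> V U"
    using tukey_le_monotone[OF UV] by (auto simp: mono_def)
  define Q where "Q s k \<longleftrightarrow> (\<forall>X\<in>filter_sets V. k \<in> \<psi> (s \<union> X))" for s k
  have Qmono: "Q t k" if "Q s k" "s \<subseteq> t" for s t k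
    unfolding Q_def
  proof
    fix X assume "X \<in> filter_sets V"
    with that(1) have "k \<in> \<psi> (s \<union> X)" by (simp add: Q_def)
    then show "k \<in> \<psi> (t \<union> X)" using mono[of "s \<union> X" "t \<union> X"] that(2) by blast
  qed
  \<comment> \<open>The implication makes the choice total: if \<open>Q s k\<close> holds, any set
    of \<open>V\<close> may be taken.\<close>
  define N where "N s k = (SOME X. X \<in> filter_sets V \<and> (\<not> Q s k \<longrightarrow> k \<notin> \<psi> (s \<union> X)))" for s k
  have NN: "N s k \<in> filter_sets V \<and> (\<not> Q s k \<longrightarrow> k \<notin> \<psi> (s \<union> N s k))" for s k
    unfolding N_def
  proof (rule someI_ex)
    show "\<exists>X. X \<in> filter_sets V \<and> (\<not> Q s k \<longrightarrow> k \<notin> \<psi> (s \<union> X))"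
    proof (cases "Q s k")
      case True
      then show ?thesis by (intro exI[of _ UNIV]) (simp add: filter_sets_def)
    next
      case False
      then obtain X where "X \<in> filter_sets V" "k \<notin> \<psi> (s \<union> X)" by (auto simp: Q_def)
      then show ?thesis by blast
    qed
  qed
  then have N: "N s k \<in> filter_sets V" and N': "\<not> Q s k \<Longrightarrow> k \<notin> \<psi> (s \<union> N s k)" for s k
    by simp_all
  let ?\<X> = "(\<lambda>(s, k). N s k) ` ({s. finite s} \<times> UNIV)"
  have "countable ?\<X>"
    by (intro countable_image countable_SIGMA countable_Collect_finite countableI_type)
  moreover have "?\<X> \<subseteq> filter_sets V" using N by auto
  ultimately have "\<exists>P\<in>filter_sets V. \<forall>Y\<in>?\<X>. finite (P - Y)"
    using V[unfolded p_point_def, THEN conjunct2, THEN spec, of ?\<X>] by (simp only: simp_thms)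
  then obtain P where P: "P \<in> filter_sets V" and "\<forall>Y\<in>?\<X>. finite (P - Y)"
    by (elim bexE)
  then have fin: "finite (P - N s k)" if "finite s" for s k
    using that by simp
  \<comment> \<open>From \<open>M\<close> on, \<open>P\<close> is contained in all of the finitely
    many witnesses \<open>N s k\<close> with \<open>s\<close> and \<open>k\<close> below
    \<open>n\<close>.\<close>
  have "\<exists>M>n. \<forall>s\<subseteq>{..<n}. \<forall>k<n. P - N s k \<subseteq> {..<M}" for n
  proof -
    define S where "S = insert n (\<Union>(s, k)\<in>Pow {..<n} \<times> {..<n}. P - N s k)"
    have "finite (P - N s k)" if "s \<in> Pow {..<n}" for s k
      using that by (intro fin) (simp add: finite_subset[OF _ finite_lessThan])
    then have "finite S"
      unfolding S_def finite_insert by (intro finite_UN_I) (simp_all add: split_beta mem_Times_iff)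
    then obtain M where M: "S \<subseteq> {..<M}" using finite_nat_iff_bounded[of S] by blast
    have "P - N s k \<subseteq> S" if "s \<subseteq> {..<n}" "k < n" for s k
      using that unfolding S_def by blast
    moreover have "n < M" using M by (auto simp: S_def)
    ultimately show ?thesis using M by (meson order_trans)
  qed
  then have "\<exists>b. \<forall>n. b n > n \<and> (\<forall>s\<subseteq>{..<n}. \<forall>k<n. P - N s k \<subseteq> {..<b n})"
    by (intro choice allI)
  then obtain b where "\<forall>n. b n > n \<and> (\<forall>s\<subseteq>{..<n}. \<forall>k<n. P - N s k \<subseteq> {..<b n})" ..
  then have b: "n < b n" "s \<subseteq> {..<n} \<Longrightarrow> k < n \<Longrightarrow> P - N s k \<subseteq> {..<b n}" for n s k
    by simp_all
  obtain a p where a: "\<And>i. a (Suc i) = b (a i)" and p: "\<And>x i. p x < i \<longleftrightarrow> x < a i"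
    using block_partition[OF b(1)] by blast
  have "\<exists>e. {x. even (p x) = e} \<in> filter_sets V"
  proof (cases "{x. even (p x)} \<in> filter_sets V")
    case True
    then show ?thesis by (intro exI[of _ True]) simp
  next
    case False
    then have "- {x. even (p x)} \<in> filter_sets V" using ultrafilter_Compl[OF uV] by blast
    then show ?thesis by (intro exI[of _ False]) (simp add: Collect_neg_eq)
  qed
  then obtain e where e: "{x. even (p x) = e} \<in> filter_sets V" by blast
  define R where "R = P \<inter> {x. even (p x) = e}"
  have R: "R \<in> filter_sets V" unfolding R_def by (intro filter_sets_Int P e)
  \<comment> \<open>\<open>j k\<close> is the first block after that of \<open>k\<close> which is
    absent from \<open>R\<close>.\<close>
  define j where "j k = (if even (p k) = e then Suc (p k) else Suc (Suc (p k)))" for k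
  have j: "p k < j k" "even (j k) \<noteq> e" for k by (auto simp: j_def)
  define f where "f X = {k. Q (X \<inter> R \<inter> {..<a (j k)}) k}" for X
  have "monotone_continuous f"
    unfolding monotone_continuous_def
  proof (intro conjI allI exI)
    show "mono f"
    proof (rule monoI, rule subsetI)
      fix X Y k assume "X \<subseteq> Y" "k \<in> f X"
      then have "Q (X \<inter> R \<inter> {..<a (j k)}) k" by (simp add: f_def)
      then have "Q (Y \<inter> R \<inter> {..<a (j k)}) k" by (rule Qmono) (use \<open>X \<subseteq> Y\<close> in blast)
      then show "k \<in> f Y" by (simp add: f_def)
    qed
    show "k \<in> f X \<longleftrightarrow> k \<in> f (X \<inter> {..<a (j k)})" for k X
      by (simp add: f_def Int_ac)
  qed
  moreover have fpsi: "f X = \<psi> (X \<inter> R)" if X: "X \<in> filter_sets V" for X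
  proof (intro set_eqI iffI)
    fix k assume "k \<in> f X"
    then have "Q (X \<inter> R \<inter> {..<a (j k)}) k" by (simp add: f_def)
    then have "k \<in> \<psi> ((X \<inter> R \<inter> {..<a (j k)}) \<union> (X \<inter> R))"
      unfolding Q_def by (rule bspec) (rule filter_sets_Int[OF X R])
    moreover have "(X \<inter> R \<inter> {..<a (j k)}) \<union> (X \<inter> R) = X \<inter> R" by auto
    ultimately show "k \<in> \<psi> (X \<inter> R)" by simp
  next
    fix k assume k: "k \<in> \<psi> (X \<inter> R)"
    let ?s = "X \<inter> R \<inter> {..<a (j k)}"
    show "k \<in> f X"
    proof (rule ccontr)
      assume "k \<notin> f X"
      then have no: "k \<notin> \<psi> (?s \<union> N ?s k)" using N' by (simp add: f_def)
      have "k < a (j k)" using j p by blast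
      then have sub: "P - N ?s k \<subseteq> {..<a (Suc (j k))}"
        unfolding a by (intro b(2)) simp_all
      \<comment> \<open>Points of \<open>R\<close> before block \<open>j k\<close> belong to
        \<open>?s\<close>, and those after it are so large that they lie in \<open>N ?s k\<close>;
        the block itself contains no point of \<open>R\<close>.\<close>
      have "X \<inter> R \<subseteq> ?s \<union> N ?s k"
      proof
        fix x assume x: "x \<in> X \<inter> R"
        show "x \<in> ?s \<union> N ?s k"
        proof (rule ccontr)
          assume "x \<notin> ?s \<union> N ?s k"
          moreover have "x \<in> P" using x by (simp add: R_def)
          ultimately have "\<not> x < a (j k)" "x < a (Suc (j k))" using x sub by blast+
          then have "p x = j k" using p[of x "j k"] p[of x "Suc (j k)"] by simp
          then show False using x j(2)[of k] by (simp add: R_def)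
        qed
      qed
      from mono[OF this] k no show False by blast
    qed
  qed
  have "cofinal_map f V U"
    unfolding cofinal_map_def
  proof (intro conjI ballI)
    fix X assume "X \<in> filter_sets V"
    then have "f X = \<psi> (X \<inter> R)" "X \<inter> R \<in> filter_sets V"
      by (rule fpsi, rule filter_sets_Int[OF _ R])
    then show "f X \<in> filter_sets U" using \<psi> unfolding cofinal_map_def by metis
  next
    fix Y assume "Y \<in> filter_sets U"
    then obtain X where X: "X \<in> filter_sets V" "\<psi> X \<subseteq> Y"
      using \<psi> unfolding cofinal_map_def by blast
    have "f X \<subseteq> Y" using fpsi[OF X(1)] mono[of "X \<inter> R" X] X(2) by auto
    with X(1) show "\<exists>X\<in>filter_sets V. f X \<subseteq> Y" by blast
  qed
  ultimately show ?thesis by blast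
qed

section \<open>A tree of generic filters\<close>

text \<open>By induction on the size bound, a nonempty finite set being a point joined to a smaller
  set; then a countable union is taken.\<close>

lemma card_Fpow_infinite:
  assumes A: "infinite A" shows "|Fpow A| \<le>o |A|"
proof -
  let ?S = "\<lambda>n. {X. X \<subseteq> A \<and> finite X \<and> card X \<le> n}"
  have le: "|?S n| \<le>o |A|" for n
  proof (induction n)
    case 0
    have "?S 0 \<subseteq> {{}}" by auto
    then have "finite (?S 0)" by (rule finite_subset) simp
    then have "|?S 0| <o natLeq" by (simp only: finite_iff_ordLess_natLeq)
    moreover have "natLeq \<le>o |A|" using A infinite_iff_natLeq_ordLeq by blast
    ultimately show ?case using ordLess_ordLeq_trans ordLess_imp_ordLeq by blast
  next
    case (Suc n)
    have "?S (Suc n) \<subseteq> insert {} ((\<lambda>(a, X). insert a X) ` (A \<times> ?S n))"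
    proof
      fix X assume X: "X \<in> ?S (Suc n)"
      show "X \<in> insert {} ((\<lambda>(a, X). insert a X) ` (A \<times> ?S n))"
      proof (cases "X = {}")
        case False
        then obtain a where "a \<in> X" by blast
        with X have "(a, X - {a}) \<in> A \<times> ?S n" "X = insert a (X - {a})" by auto
        then show ?thesis by (intro insertI2 image_eqI[of _ _ "(a, X - {a})"]) simp_all
      qed simp
    qed
    then have "|?S (Suc n)| \<le>o |insert {} ((\<lambda>(a, X). insert a X) ` (A \<times> ?S n))|"
      by (rule card_of_mono1)
    also have "insert {} ((\<lambda>(a, X). insert a X) ` (A \<times> ?S n)) =
        {{}} \<union> (\<lambda>(a, X). insert a X) ` (A \<times> ?S n)" by simp
    also have "|{{}} \<union> (\<lambda>(a, X). insert a X) ` (A \<times> ?S n)| \<le>o |A|"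
    proof (rule card_of_Un_ordLeq_infinite_Field)
      show "|{{} :: 'a set}| \<le>o |A|"
        using A by (intro card_of_singl_ordLeq) auto
      have "|A \<times> ?S n| \<le>o |A|"
        using A Suc by (intro card_of_Times_ordLeq_infinite_Field)
          (simp_all add: Field_card_of card_of_card_order_on card_of_mono1)
      then show "|(\<lambda>(a, X). insert a X) ` (A \<times> ?S n)| \<le>o |A|"
        by (rule ordLeq_transitive[OF card_of_image])
    qed (use A in \<open>simp_all add: Field_card_of card_of_card_order_on\<close>)
    finally show ?case .
  qed
  have "Fpow A = (\<Union>n. ?S n)" by (auto simp: Fpow_def)
  moreover have "|UNIV::nat set| \<le>o |A|" using A infinite_iff_card_of_nat by blast
  then have "|\<Union>n. ?S n| \<le>o |A|" using le by (intro card_of_UNION_ordLeq_infinite[OF A]) blast+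
  ultimately show ?thesis by simp
qed

lemma card_Fpow_nat_continuum:
  assumes "|I| <o continuum" shows "|Fpow I \<times> (UNIV::nat set)| <o continuum"
proof (cases "finite I")
  case True
  then have "finite (Fpow I)" using finite_subset[OF Fpow_subset_Pow, of I] by simp
  then have "countable (Fpow I \<times> (UNIV::nat set))"
    by (intro countable_SIGMA) (simp_all add: countable_finite)
  then show ?thesis by (rule card_countable_continuum)
next
  case False
  then have "|Fpow I \<times> (UNIV::nat set)| \<le>o |I|"
    using card_Fpow_infinite[OF False] infinite_iff_card_of_nat[of I]
    by (intro card_of_Times_ordLeq_infinite_Field) (simp_all add: Field_card_of card_of_card_order_on)
  then show ?thesis using assms ordLeq_ordLess_trans by blast
qed

text \<open>The infimum with \<open>cofinite\<close> adds all cofinite sets. The result may be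
  \<open>bot\<close>; properness is a separate matter.\<close>

definition generated_filter :: "('i \<Rightarrow> nat set) \<Rightarrow> 'i set \<Rightarrow> nat filter" where
  "generated_filter X I = inf cofinite (INF i\<in>I. principal (X i))"

lemma generated_filter_le_cofinite: "generated_filter X I \<le> cofinite"
  by (simp add: generated_filter_def)

lemma generated_filter_le_principal: "i \<in> I \<Longrightarrow> generated_filter X I \<le> principal (X i)"
  unfolding generated_filter_def by (intro le_infI2 INF_lower)

lemma generated_filter_antimono: "J \<subseteq> I \<Longrightarrow> generated_filter X I \<le> generated_filter X J"
  unfolding generated_filter_def by (intro inf_mono order_refl INF_superset_mono)

lemma filter_sets_generated_filter:
  "Y \<in> filter_sets (generated_filter X I) \<longleftrightarrow> (\<exists>J\<in>Fpow I. \<exists>n. (\<Inter>i\<in>J. X i) - {..<n} \<subseteq> Y)"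
proof
  assume "Y \<in> filter_sets (generated_filter X I)"
  then obtain Q R where Q: "eventually Q cofinite" and R: "eventually R (INF i\<in>I. principal (X i))"
    and QR: "\<And>x. Q x \<Longrightarrow> R x \<Longrightarrow> x \<in> Y"
    unfolding filter_sets_def generated_filter_def eventually_inf by blast
  obtain J where J: "J \<subseteq> I" "finite J" "eventually R (INF i\<in>J. principal (X i))"
    using R unfolding eventually_INF[of R _ I] by blast
  then have "\<And>x. x \<in> (\<Inter>i\<in>J. X i) \<Longrightarrow> R x"
    by (simp add: INF_principal_finite eventually_principal)
  moreover obtain n where "{x. \<not> Q x} \<subseteq> {..<n}"
    using Q finite_nat_iff_bounded[of "{x. \<not> Q x}"] by (auto simp: eventually_cofinite)
  ultimately have "(\<Inter>i\<in>J. X i) - {..<n} \<subseteq> Y" using QR by blast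
  then show "\<exists>J\<in>Fpow I. \<exists>n. (\<Inter>i\<in>J. X i) - {..<n} \<subseteq> Y" using J by (auto simp: Fpow_def)
next
  assume "\<exists>J\<in>Fpow I. \<exists>n. (\<Inter>i\<in>J. X i) - {..<n} \<subseteq> Y"
  then obtain J n where J: "J \<subseteq> I" "finite J" "(\<Inter>i\<in>J. X i) - {..<n} \<subseteq> Y" by (auto simp: Fpow_def)
  have "\<forall>\<^sub>F x in generated_filter X I. \<forall>i\<in>J. x \<in> X i"
    using J generated_filter_le_principal[of _ I X]
    by (intro eventually_ball_finite) (auto simp: le_principal)
  then have "(\<Inter>i\<in>J. X i) \<in> filter_sets (generated_filter X I)"
    by (simp add: filter_sets_def)
  then have "(\<Inter>i\<in>J. X i) - {..<n} \<in> filter_sets (generated_filter X I)"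
    by (intro filter_sets_finite_diff generated_filter_le_cofinite) simp_all
  then show "Y \<in> filter_sets (generated_filter X I)" using J(3) by (rule filter_sets_mono)
qed

lemma small_filter_generated:
  assumes "|I| <o continuum" "generated_filter X I \<noteq> bot"
  shows "small_filter (generated_filter X I)"
proof -
  let ?B = "(\<lambda>(J, n::nat). (\<Inter>i\<in>J. X i) - {..<n}) ` (Fpow I \<times> UNIV)"
  have "filter_base ?B (generated_filter X I)"
    unfolding filter_base_def
  proof (intro conjI subsetI ballI)
    fix Y assume "Y \<in> ?B"
    then show "Y \<in> filter_sets (generated_filter X I)"
      unfolding filter_sets_generated_filter by auto
  next
    fix Y assume "Y \<in> filter_sets (generated_filter X I)"
    then obtain J n where "J \<in> Fpow I" "(\<Inter>i\<in>J. X i) - {..<n} \<subseteq> Y"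
      unfolding filter_sets_generated_filter by blast
    then show "\<exists>B\<in>?B. B \<subseteq> Y" by (intro bexI[of _ "(\<Inter>i\<in>J. X i) - {..<n}"]) auto
  qed
  moreover have "|?B| <o continuum"
    using card_of_image card_Fpow_nat_continuum[OF assms(1)] ordLeq_ordLess_trans by blast
  ultimately show ?thesis
    using assms(2) generated_filter_le_cofinite unfolding small_filter_def by blast
qed

text \<open>A failure involves only finitely many generators. The set with the last of these indices
  is positive for the filter generated before it, which contains the intersection of the others.
  This covers successor and limit stages alike.\<close>

lemma generated_filter_not_bot:
  assumes r: "Well_order r"
    and X: "\<And>i. i \<in> I \<Longrightarrow> i \<in> Field r \<and> (\<exists>\<^sub>F x in generated_filter X (underS r i). x \<in> X i)"
  shows "generated_filter X I \<noteq> bot"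
proof
  assume "generated_filter X I = bot"
  then have "{} \<in> filter_sets (generated_filter X I)" by (simp add: filter_sets_def)
  then obtain J n where J: "J \<subseteq> I" "finite J" and e: "(\<Inter>i\<in>J. X i) - {..<n} \<subseteq> {}"
    unfolding filter_sets_generated_filter by (auto simp: Fpow_def)
  have "\<not> (UNIV :: nat set) \<subseteq> {..<n}" by (metis finite_lessThan finite_subset infinite_UNIV_nat)
  then have "J \<noteq> {}" using e by auto
  have "\<exists>m\<in>J. \<forall>i\<in>J. i = m \<or> i \<in> underS r m"
    using J(2) \<open>J \<noteq> {}\<close> J(1)
  proof (induction J rule: finite_ne_induct)
    case (insert a J)
    then obtain m where m: "m \<in> J" "\<And>i. i \<in> J \<Longrightarrow> i = m \<or> i \<in> underS r m" by blast
    have F: "m \<in> Field r" "a \<in> Field r" using m insert.prems X by auto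
    have tr: "trans r" and tot: "total_on (Field r) r" and an: "antisym r"
      using r by (simp_all add: order_on_defs)
    have "a \<noteq> m" using insert m by auto
    then consider "(a, m) \<in> r" | "(m, a) \<in> r" using tot F unfolding total_on_def by blast
    then show ?case
    proof cases
      case 1
      then show ?thesis using m \<open>a \<noteq> m\<close> by (intro bexI[of _ m]) (auto simp: underS_def)
    next
      case 2
      have "i \<in> underS r a" if "i \<in> J" for i
        using m(2)[OF that] 2 \<open>a \<noteq> m\<close> tr an unfolding underS_def trans_def antisym_def by blast
      then show ?thesis by (intro bexI[of _ a]) auto
    qed
  qed auto
  then obtain m where m: "m \<in> J" "\<And>i. i \<in> J \<Longrightarrow> i = m \<or> i \<in> underS r m" by blast
  have "J - {m} \<in> Fpow (underS r m)" using J m by (auto simp: Fpow_def)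
  then have "(\<Inter>i\<in>J - {m}. X i) - {..<n} \<in> filter_sets (generated_filter X (underS r m))"
    unfolding filter_sets_generated_filter by blast
  moreover have "\<exists>\<^sub>F x in generated_filter X (underS r m). x \<in> X m" using X m J by blast
  ultimately have "\<exists>\<^sub>F x in generated_filter X (underS r m). x \<in> (\<Inter>i\<in>J - {m}. X i) - {..<n} \<and> x \<in> X m"
    unfolding filter_sets_def by (intro frequently_eventually_conj) auto
  then obtain x where "x \<in> (\<Inter>i\<in>J - {m}. X i) - {..<n}" "x \<in> X m" by (auto dest: frequently_ex)
  then have "x \<in> (\<Inter>i\<in>J. X i) - {..<n}" using m by auto
  with e show False by blast
qed

text \<open>The sets \<open>T \<alpha>\<close> are requirements. At stage \<open>\<alpha>\<close>
  the branch \<open>x\<close> enters the half, chosen by the bit \<open>x \<alpha>\<close>, of a set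
  splitting the filter built so far, and meets \<open>T \<alpha>\<close> within it. Branches first
  differing at \<open>\<alpha>\<close> receive disjoint sets there, so \<open>V\<close> is
  injective.\<close>

lemma generic_tree:
  fixes T :: "(nat \<Rightarrow> bool) \<Rightarrow> nat filter set"
  assumes split: "\<And>F. small_filter F \<Longrightarrow> \<exists>E. (\<exists>\<^sub>F x in F. x \<in> E) \<and> (\<exists>\<^sub>F x in F. x \<notin> E)"
    and dense: "\<And>\<alpha> F. small_filter F \<Longrightarrow> \<exists>X. (\<exists>\<^sub>F x in F. x \<in> X) \<and> inf F (principal X) \<in> T \<alpha>"
  shows "\<exists>V :: ((nat \<Rightarrow> bool) \<Rightarrow> bool) \<Rightarrow> nat filter. inj V \<and>
    (\<forall>x. V x \<noteq> bot \<and> V x \<le> cofinite \<and> (\<forall>\<alpha>. \<exists>F\<in>T \<alpha>. V x \<le> F))"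
proof -
  let ?r = continuum
  have wo: "Well_order ?r" using Card_order_continuum by (simp add: card_order_on_def Field_continuum)
  have wf: "wf (?r - Id)" using wo by (simp add: well_order_on_def)
  define E where "E F = (SOME E. (\<exists>\<^sub>F x in F. x \<in> E) \<and> (\<exists>\<^sub>F x in F. x \<notin> E))" for F :: "nat filter"
  have E: "(\<exists>\<^sub>F x in F. x \<in> E F) \<and> (\<exists>\<^sub>F x in F. x \<notin> E F)" if "small_filter F" for F
    unfolding E_def using split[OF that] by (rule someI_ex)
  define side where "side b F = (if b then E F else - E F)" for b F
  have side: "\<exists>\<^sub>F x in F. x \<in> side b F" if "small_filter F" for b F
    using E[OF that] by (simp add: side_def)
  define step where "step b \<alpha> F = (SOME Y. Y \<subseteq> side b F \<and>
    (\<exists>\<^sub>F x in F. x \<in> Y) \<and> inf F (principal Y) \<in> T \<alpha>)" for b \<alpha> F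
  have step: "step b \<alpha> F \<subseteq> side b F \<and> (\<exists>\<^sub>F x in F. x \<in> step b \<alpha> F) \<and>
      inf F (principal (step b \<alpha> F)) \<in> T \<alpha>" if F: "small_filter F" for b \<alpha> F
    unfolding step_def
  proof (rule someI_ex)
    obtain X where X: "\<exists>\<^sub>F x in inf F (principal (side b F)). x \<in> X"
      "inf (inf F (principal (side b F))) (principal X) \<in> T \<alpha>"
      using dense[OF small_filter_inf[OF F side[OF F]]] by blast
    then have "(\<exists>\<^sub>F x in F. x \<in> side b F \<inter> X) \<and> inf F (principal (side b F \<inter> X)) \<in> T \<alpha>"
      by (simp add: frequently_inf_principal inf_assoc)
    then show "\<exists>Y. Y \<subseteq> side b F \<and> (\<exists>\<^sub>F x in F. x \<in> Y) \<and> inf F (principal Y) \<in> T \<alpha>"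
      by (intro exI[of _ "side b F \<inter> X"]) simp
  qed
  have "\<exists>X. \<forall>\<alpha>. X \<alpha> = step (x \<alpha>) \<alpha> (generated_filter X (underS ?r \<alpha>))" for x
  proof (rule dependent_wf_choice[OF wf])
    fix f g :: "(nat \<Rightarrow> bool) \<Rightarrow> nat set" and \<alpha> Y
    assume "\<And>z. (z, \<alpha>) \<in> ?r - Id \<Longrightarrow> f z = g z"
    then have "generated_filter f (underS ?r \<alpha>) = generated_filter g (underS ?r \<alpha>)"
      unfolding generated_filter_def underS_def by (intro arg_cong2[of _ _ _ _ inf] INF_cong) auto
    then show "(Y = step (x \<alpha>) \<alpha> (generated_filter f (underS ?r \<alpha>))) =
        (Y = step (x \<alpha>) \<alpha> (generated_filter g (underS ?r \<alpha>)))" by simp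
  qed blast
  then have "\<exists>X. \<forall>x \<alpha>. X x \<alpha> = step (x \<alpha>) \<alpha> (generated_filter (X x) (underS ?r \<alpha>))"
    by (intro choice allI)
  then obtain X where X: "X x \<alpha> = step (x \<alpha>) \<alpha> (generated_filter (X x) (underS ?r \<alpha>))" for x \<alpha>
    by blast
  have small: "small_filter (generated_filter (X x) (underS ?r \<alpha>))" for x \<alpha>
    using wf
  proof (induction \<alpha>)
    case (less \<alpha>)
    have "generated_filter (X x) (underS ?r \<alpha>) \<noteq> bot"
    proof (rule generated_filter_not_bot[OF wo])
      fix \<beta> assume "\<beta> \<in> underS ?r \<alpha>"
      then have "(\<beta>, \<alpha>) \<in> ?r - Id" by (auto simp: underS_def)
      from step[OF less.IH[OF this], of "x \<beta>" \<beta>]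
      show "\<beta> \<in> Field ?r \<and> (\<exists>\<^sub>F y in generated_filter (X x) (underS ?r \<beta>). y \<in> X x \<beta>)"
        by (simp add: Field_continuum X[of x \<beta>, symmetric])
    qed
    \<comment> \<open>Proper initial segments of a cardinal well-order are smaller than the
      cardinal, so the filter at every stage is still small.\<close>
    moreover have "|underS ?r \<alpha>| <o continuum"
      by (rule card_of_underS[OF Card_order_continuum]) (simp add: Field_continuum)
    ultimately show ?case by (intro small_filter_generated)
  qed
  have X_side: "X x \<alpha> \<subseteq> side (x \<alpha>) (generated_filter (X x) (underS ?r \<alpha>))"
    and X_freq: "\<exists>\<^sub>F y in generated_filter (X x) (underS ?r \<alpha>). y \<in> X x \<alpha>"
    and X_T: "inf (generated_filter (X x) (underS ?r \<alpha>)) (principal (X x \<alpha>)) \<in> T \<alpha>" for x \<alpha>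
    using step[OF small, of "x \<alpha>" \<alpha> x \<alpha>] by (simp_all add: X[of x \<alpha>, symmetric])
  define V where "V x = generated_filter (X x) UNIV" for x
  have V_bot: "V x \<noteq> bot" for x
    unfolding V_def by (rule generated_filter_not_bot[OF wo]) (simp add: Field_continuum X_freq)
  have V_le: "V x \<le> principal (X x \<alpha>)" for x \<alpha>
    unfolding V_def by (rule generated_filter_le_principal) simp
  have "inj V"
  proof (rule injI, rule ccontr)
    fix x y assume eq: "V x = V y" and "x \<noteq> y"
    then obtain \<gamma> where "\<gamma> \<in> {\<gamma>. x \<gamma> \<noteq> y \<gamma>}" by blast
    from wfE_min[OF wf this] obtain \<alpha> where \<alpha>: "x \<alpha> \<noteq> y \<alpha>" and min: "\<And>\<beta>. (\<beta>, \<alpha>) \<in> ?r - Id \<Longrightarrow> x \<beta> = y \<beta>"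
      by auto
    have gen_eq: "generated_filter (X x) (underS ?r \<beta>) = generated_filter (X y) (underS ?r \<beta>)"
      if "\<And>\<gamma>. (\<gamma>, \<beta>) \<in> ?r - Id \<Longrightarrow> X x \<gamma> = X y \<gamma>" for \<beta>
      using that unfolding generated_filter_def underS_def
      by (intro arg_cong2[of _ _ _ _ inf] INF_cong) auto
    \<comment> \<open>Below their first difference both branches make the same choices, so at
      \<open>\<alpha>\<close> they split the same filter.\<close>
    have "(\<beta>, \<alpha>) \<in> ?r - Id \<Longrightarrow> X x \<beta> = X y \<beta>" for \<beta>
      using wf
    proof (induction \<beta>)
      case (less \<beta>)
      have "(\<gamma>, \<alpha>) \<in> ?r - Id" if "(\<gamma>, \<beta>) \<in> ?r - Id" for \<gamma>
        using that less.prems wo unfolding order_on_defs trans_def antisym_def by blast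
      then have "generated_filter (X x) (underS ?r \<beta>) = generated_filter (X y) (underS ?r \<beta>)"
        using less.IH by (intro gen_eq) blast
      then show ?case using min[OF less.prems] X[of x \<beta>] X[of y \<beta>] by simp
    qed
    then have "generated_filter (X x) (underS ?r \<alpha>) = generated_filter (X y) (underS ?r \<alpha>)"
      by (intro gen_eq)
    then have "X x \<alpha> \<inter> X y \<alpha> = {}"
      using X_side[of x \<alpha>] X_side[of y \<alpha>] \<alpha> by (auto simp: side_def split: if_splits)
    moreover have "V x \<le> inf (principal (X x \<alpha>)) (principal (X y \<alpha>))"
      using V_le[of x \<alpha>] V_le[of y \<alpha>] eq by (intro inf_greatest) simp_all
    ultimately have "V x \<le> bot" by simp
    then show False using V_bot[of x] by (simp add: bot_unique)
  qed
  moreover have "\<exists>F\<in>T \<alpha>. V x \<le> F" for x \<alpha>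
  proof (rule bexI[OF _ X_T])
    show "V x \<le> inf (generated_filter (X x) (underS ?r \<alpha>)) (principal (X x \<alpha>))"
      using V_le unfolding V_def by (intro inf_greatest generated_filter_antimono) auto
  qed
  moreover have "V x \<le> cofinite" for x
    unfolding V_def by (rule generated_filter_le_cofinite)
  ultimately show ?thesis using V_bot by blast
qed

section \<open>Free sets\<close>

definition free_set :: "('a \<Rightarrow> 'a set) \<Rightarrow> 'a set \<Rightarrow> bool" where
  "free_set F A \<longleftrightarrow> (\<forall>x\<in>A. \<forall>y\<in>A. x \<noteq> y \<longrightarrow> y \<notin> F x)"

text \<open>Zorn's lemma: freeness concerns pairs of points, so it passes to unions of
  chains.\<close>

lemma maximal_free_subset:
  "\<exists>B\<subseteq>L. free_set F B \<and> (\<forall>x\<in>L - B. \<not> free_set F (insert x B))"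
proof -
  have "\<exists>M\<in>{B. B \<subseteq> L \<and> free_set F B}. \<forall>X\<in>{B. B \<subseteq> L \<and> free_set F B}. M \<subseteq> X \<longrightarrow> X = M"
  proof (rule subset_Zorn')
    fix C assume C: "subset.chain {B. B \<subseteq> L \<and> free_set F B} C"
    have "free_set F (\<Union>C)"
      unfolding free_set_def
    proof (intro ballI impI)
      fix x y assume "x \<in> \<Union>C" "y \<in> \<Union>C" "x \<noteq> y"
      then obtain X Y where XY: "X \<in> C" "x \<in> X" "Y \<in> C" "y \<in> Y" by blast
      then have "X \<subseteq> Y \<or> Y \<subseteq> X" using C by (auto simp: subset_chain_def)
      then obtain Z where "Z \<in> C" "x \<in> Z" "y \<in> Z" using XY by blast
      moreover have "free_set F Z" using C \<open>Z \<in> C\<close> by (auto simp: subset_chain_def)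
      ultimately show "y \<notin> F x" using \<open>x \<noteq> y\<close> by (auto simp: free_set_def)
    qed
    moreover have "\<Union>C \<subseteq> L" using C by (auto simp: subset_chain_def)
    ultimately show "\<Union>C \<in> {B. B \<subseteq> L \<and> free_set F B}" by simp
  qed
  then obtain M where "M \<in> {B. B \<subseteq> L \<and> free_set F B}"
    and "\<forall>X\<in>{B. B \<subseteq> L \<and> free_set F B}. M \<subseteq> X \<longrightarrow> X = M"
    by (elim bexE)
  then have M: "M \<subseteq> L" "free_set F M"
    and max: "X \<subseteq> L \<Longrightarrow> free_set F X \<Longrightarrow> M \<subseteq> X \<Longrightarrow> X = M" for X
    by simp_all
  have "\<not> free_set F (insert x M)" if "x \<in> L - M" for x
    using max[of "insert x M"] that M(1) by blast
  with M show ?thesis by (intro exI[of _ M]) simp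
qed

lemma not_free_insert:
  assumes "free_set F B" "\<not> free_set F (insert x B)"
  shows "(\<exists>y\<in>B. y \<in> F x) \<or> (\<exists>y\<in>B. x \<in> F y)"
  using assms unfolding free_set_def by blast

lemma Well_order_cases:
  assumes "Well_order r" "i \<in> Field r" "j \<in> Field r" "i \<noteq> j"
  shows "(i, j) \<in> r - Id \<or> (j, i) \<in> r - Id"
  using assms by (auto simp: order_on_defs total_on_def)

text \<open>
  Split off disjoint maximal free sets \<open>A i\<close> for \<open>i < r\<^sup>+\<close>. If all of them are smaller than \<open>K\<close>, some
  \<open>x\<close> lies outside their union and its image; by maximality \<open>F x\<close> meets every \<open>A i\<close>, so it is too large.
\<close>

lemma free_set_regular:
  assumes K: "infinite K" "stable |K|"
    and r: "Cinfinite r" "cardSuc r <o |K|"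
    and F: "\<And>x. x \<in> K \<Longrightarrow> |F x| \<le>o r"
  shows "\<exists>A\<subseteq>K. |A| =o |K| \<and> free_set F A"
proof (rule ccontr)
  assume no: "\<not> ?thesis"
  let ?s = "cardSuc r" and ?M = "Field (cardSuc r)"
  have cs: "Card_order ?s" using r by (simp add: cardSuc_Card_order)
  then have wo: "Well_order ?s" by (simp add: card_order_on_well_order_on)
  have wf: "wf (?s - Id)" using wo by (simp add: well_order_on_def)
  have M: "|?M| =o ?s" using cs by (rule card_of_Field_ordIso)
  have rs: "r <o ?s" using r by (simp add: cardSuc_greater)
  have rK: "r <o |K|" using rs r(2) by (rule ordLess_transitive)
  have MK: "|?M| <o |K|" using M r(2) by (rule ordIso_ordLess_trans)
  have "\<exists>A. \<forall>i. A i \<subseteq> K - (\<Union>j\<in>underS ?s i. A j) \<and> free_set F (A i) \<and>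
      (\<forall>x\<in>K - (\<Union>j\<in>underS ?s i. A j) - A i. \<not> free_set F (insert x (A i)))"
  proof (rule dependent_wf_choice[OF wf])
    fix f g :: "_ \<Rightarrow> 'a set" and i B
    assume "\<And>z. (z, i) \<in> ?s - Id \<Longrightarrow> f z = g z"
    then have "(\<Union>j\<in>underS ?s i. f j) = (\<Union>j\<in>underS ?s i. g j)"
      by (intro SUP_cong) (auto simp: underS_def)
    then show "(B \<subseteq> K - (\<Union>j\<in>underS ?s i. f j) \<and> free_set F B \<and>
        (\<forall>x\<in>K - (\<Union>j\<in>underS ?s i. f j) - B. \<not> free_set F (insert x B))) =
      (B \<subseteq> K - (\<Union>j\<in>underS ?s i. g j) \<and> free_set F B \<and>
        (\<forall>x\<in>K - (\<Union>j\<in>underS ?s i. g j) - B. \<not> free_set F (insert x B)))"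
      by simp
  qed (rule maximal_free_subset)
  then obtain A where "\<forall>i. A i \<subseteq> K - (\<Union>j\<in>underS ?s i. A j) \<and> free_set F (A i) \<and>
      (\<forall>x\<in>K - (\<Union>j\<in>underS ?s i. A j) - A i. \<not> free_set F (insert x (A i)))" ..
  then have A: "A i \<subseteq> K - (\<Union>j\<in>underS ?s i. A j)" "free_set F (A i)"
      "x \<in> K - (\<Union>j\<in>underS ?s i. A j) - A i \<Longrightarrow> \<not> free_set F (insert x (A i))" for i x
    by simp_all
  have AK: "A i \<subseteq> K" for i using A(1) by blast
  have A_less: "|A i| <o |K|" for i
  proof -
    have "\<not> |A i| =o |K|" using no A(2)[of i] AK[of i] by blast
    then show ?thesis using card_of_mono1[OF AK[of i]] by (simp add: ordLeq_iff_ordLess_or_ordIso)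
  qed
  have disj: "A i \<inter> A j = {}" if "i \<in> ?M" "j \<in> ?M" "i \<noteq> j" for i j
    using Well_order_cases[OF wo that] A(1)[of i] A(1)[of j] by (auto simp: underS_def)
  \<comment> \<open>Stability of \<open>|K|\<close> keeps this union of fewer than
    \<open>|K|\<close> smaller sets below \<open>|K|\<close>.\<close>
  define U where "U = (\<Union>i\<in>?M. A i \<union> (\<Union>a\<in>A i. F a))"
  have "|U| <o |K|"
    unfolding U_def
  proof (rule stable_UNION[OF K(2) MK])
    fix i
    have "|F a| <o |K|" if "a \<in> A i" for a
      using ordLeq_ordLess_trans[OF F rK] AK[of i] that by blast
    then have "|\<Union>a\<in>A i. F a| <o |K|" by (intro stable_UNION[OF K(2) A_less])
    then show "|A i \<union> (\<Union>a\<in>A i. F a)| <o |K|"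
      by (intro card_of_Un_ordLess_infinite[OF K(1) A_less])
  qed
  then obtain x where x: "x \<in> K" "x \<notin> U"
    using card_of_mono1[of K U] not_ordLess_ordLeq[of "|U|" "|K|"] by blast
  have "\<exists>y. y \<in> A i \<and> y \<in> F x" if i: "i \<in> ?M" for i
  proof -
    have "x \<notin> A j" if "j \<in> ?M" for j using x(2) that by (auto simp: U_def)
    moreover have "underS ?s i \<subseteq> ?M" by (auto simp: underS_def Field_def)
    ultimately have "x \<in> K - (\<Union>j\<in>underS ?s i. A j) - A i" using x(1) i by blast
    from not_free_insert[OF A(2) A(3)[OF this]] show ?thesis
      using x(2) i by (auto simp: U_def)
  qed
  then have "\<exists>g. \<forall>i\<in>?M. g i \<in> A i \<and> g i \<in> F x" by (intro bchoice ballI)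
  then obtain g where g: "\<And>i. i \<in> ?M \<Longrightarrow> g i \<in> A i \<and> g i \<in> F x" by blast
  have "inj_on g ?M"
  proof (rule inj_onI, rule ccontr)
    fix i j assume "i \<in> ?M" "j \<in> ?M" "g i = g j" "i \<noteq> j"
    then show False using g[of i] g[of j] disj[of i j] by auto
  qed
  then have "|?M| \<le>o |F x|" using g by (intro card_of_ordLeqI) auto
  then have "|?M| \<le>o r" using F[OF x(1)] by (rule ordLeq_transitive)
  then have "?s \<le>o r" by (rule ordIso_ordLeq_trans[OF ordIso_symmetric[OF M]])
  with rs show False using not_ordLess_ordLeq by blast
qed

text \<open>
  The same idea carried out in layers, one for each \<open>\<eta>\<close> in \<open>K\<close>: in layer \<open>\<eta>\<close> the sets \<open>A (\<eta>, i)\<close>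
  are capped at the cardinality of the segment below \<open>\<eta>\<close>, and free also from all \<open>A (\<xi>, i)\<close> in earlier
  layers. In each layer at most \<open>r\<close> indices \<open>i\<close> miss the cap, so some \<open>i\<close> attains it in every layer of a
  short cofinal set \<open>I\<close>, and the union of these \<open>A (\<eta>, i)\<close> has full size.
\<close>

lemma free_set_singular:
  assumes K: "infinite K" "\<not> regularCard |K|"
    and r: "Cinfinite r" "r <o |K|"
    and F: "\<And>x. x \<in> K \<Longrightarrow> |F x| \<le>o r"
  shows "\<exists>A\<subseteq>K. |A| =o |K| \<and> free_set F A"
proof -
  let ?k = "|K|"
  have fK: "Field ?k = K" by (rule Field_card_of)
  have cK: "Card_order ?k" by (rule card_of_Card_order)
  obtain I where I: "I \<subseteq> K" "cofinal I ?k" "\<not> |I| =o ?k"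
    using K(2) unfolding regularCard_def fK by blast
  have IK: "|I| <o ?k"
    using I(3) card_of_mono1[OF I(1)] by (simp add: ordLeq_iff_ordLess_or_ordIso)
  \<comment> \<open>At most \<open>r\<close> bad indices in each of \<open>|I|\<close> layers make
    at most \<open>t\<close> in all, so some index below the successor of \<open>t\<close> is good
    in every layer of \<open>I\<close>.\<close>
  define t where "t = |I| +c r"
  have t: "Cinfinite t" unfolding t_def using r by (intro Cinfinite_csum) simp
  have It: "|I| \<le>o t" unfolding t_def by (rule ordLeq_csum1[OF card_of_Card_order])
  have rt: "r \<le>o t" unfolding t_def using r by (intro ordLeq_csum2) simp
  have tK: "t <o ?k"
    unfolding t_def csum_def
  proof (rule card_of_Plus_ordLess_infinite[OF K(1)])
    show "|Field |I| | <o ?k" using IK by (simp add: Field_card_of)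
    show "|Field r| <o ?k" using r(2) by (rule ordLess_Field)
  qed
  let ?s = "cardSuc t" and ?M = "Field (cardSuc t)"
  have cs: "Cinfinite ?s" using t by (rule Cinfinite_cardSuc)
  then have wos: "Well_order ?s" by (simp add: card_order_on_well_order_on)
  have wok: "Well_order ?k" by (rule card_of_Well_order)
  have M: "|?M| =o ?s" using cs by (simp add: card_of_Field_ordIso)
  have infM: "infinite ?M" using cs by (simp add: cinfinite_def)
  have "?s \<le>o ?k" using t tK cK by (simp add: cardSuc_least)
  \<comment> \<open>Infinite successor cardinals are regular, whereas \<open>|K|\<close> is
    singular.\<close>
  moreover have "\<not> ?s =o ?k"
    using regularCard_ordIso[OF _ cs regularCard_cardSuc[OF t]] K(2) by blast
  ultimately have sK: "?s <o ?k" by (simp add: ordLeq_iff_ordLess_or_ordIso)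
  have MK: "|?M| <o ?k" using M sK by (rule ordIso_ordLess_trans)
  have ts: "t <o ?s" using t by (simp add: cardSuc_greater)
  \<comment> \<open>Lexicographic recursion: a layer is completed for all indices before the next
    one begins.\<close>
  let ?R = "(?k - Id) <*lex*> (?s - Id)"
  have wf: "wf ?R" using wok wos by (intro wf_lex_prod) (simp_all add: well_order_on_def)
  define prev where "prev A p = (\<Union>q\<in>{q. (q, p) \<in> ?R \<and> snd q \<in> ?M}. A q)" for A :: "_ \<Rightarrow> 'a set" and p
  define L where "L A p = {x \<in> K. x \<notin> prev A p \<and>
      (\<forall>\<xi>\<in>underS ?k (fst p). F x \<inter> A (\<xi>, snd p) = {} \<and> (\<forall>a\<in>A (\<xi>, snd p). x \<notin> F a))}"
    for A :: "_ \<Rightarrow> 'a set" and p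
  define P where "P A p B \<longleftrightarrow> B \<subseteq> L A p \<and> free_set F B \<and> |B| \<le>o |underS ?k (fst p)| \<and>
      ( |underS ?k (fst p)| \<le>o |B| \<or> (\<forall>x\<in>L A p - B. \<not> free_set F (insert x B)))"
    for A :: "_ \<Rightarrow> 'a set" and p B
  have "\<exists>A. \<forall>p. P A p (A p)"
  proof (rule dependent_wf_choice[OF wf])
    fix f g :: "_ \<Rightarrow> 'a set" and p B
    assume eq: "\<And>q. (q, p) \<in> ?R \<Longrightarrow> f q = g q"
    have "prev f p = prev g p" unfolding prev_def by (intro SUP_cong refl eq) simp
    moreover have "f (\<xi>, snd p) = g (\<xi>, snd p)" if "\<xi> \<in> underS ?k (fst p)" for \<xi>
      using that by (intro eq) (cases p, auto simp: underS_def)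
    ultimately have "L f p = L g p" unfolding L_def by auto
    then show "P f p B = P g p B" unfolding P_def by simp
  next
    fix p and A :: "_ \<Rightarrow> 'a set"
    obtain B where B: "B \<subseteq> L A p" "free_set F B" "\<forall>x\<in>L A p - B. \<not> free_set F (insert x B)"
      using maximal_free_subset[of "L A p" F] by (elim exE conjE)
    show "\<exists>B. P A p B"
    \<comment> \<open>A maximal free set reaching the cap is cut down to a subset of exactly the
      cap's size.\<close>
    proof (cases "|underS ?k (fst p)| \<le>o |B|")
      case True
      then obtain C where C: "C \<subseteq> B" "|underS ?k (fst p)| =o |C|"
        using internalize_card_of_ordLeq2[of "underS ?k (fst p)" B] by blast
      have "free_set F C" using B(2) C(1) unfolding free_set_def by blast
      moreover have "|C| \<le>o |underS ?k (fst p)|" "|underS ?k (fst p)| \<le>o |C|"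
        using C(2) by (simp_all add: ordIso_iff_ordLeq)
      ultimately have "P A p C" unfolding P_def using B(1) C(1) by blast
      then show ?thesis by blast
    next
      case False
      then have "|B| \<le>o |underS ?k (fst p)|"
        using ordLeq_total[OF card_of_Well_order card_of_Well_order] by blast
      then have "P A p B" unfolding P_def using B by blast
      then show ?thesis by blast
    qed
  qed
  then obtain A where PA: "\<And>p. P A p (A p)" by blast
  have AL: "A p \<subseteq> L A p" and Afree: "free_set F (A p)" and Acard: "|A p| \<le>o |underS ?k (fst p)|"
    and Amax: "|underS ?k (fst p)| \<le>o |A p| \<or> (\<forall>x\<in>L A p - A p. \<not> free_set F (insert x (A p)))" for p
    using PA[of p] unfolding P_def by blast+
  have AK: "A p \<subseteq> K" for p using AL[of p] unfolding L_def by blast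
  have Rdisj: "A p \<inter> A q = {}" if "(q, p) \<in> ?R" "snd q \<in> ?M" for p q
  proof -
    have "A q \<subseteq> prev A p" using that unfolding prev_def by blast
    then show ?thesis using AL[of p] unfolding L_def by blast
  qed
  have disj: "A (\<xi>, i) \<inter> A (\<eta>, j) = {}" if ij: "\<xi> \<in> K" "\<eta> \<in> K" "i \<in> ?M" "j \<in> ?M" "i \<noteq> j" for \<xi> \<eta> i j
  proof -
    have "((\<xi>, i), (\<eta>, j)) \<in> ?R \<or> ((\<eta>, j), (\<xi>, i)) \<in> ?R"
    proof (cases "\<xi> = \<eta>")
      case True
      then show ?thesis using Well_order_cases[OF wos ij(3-5)] by auto
    next
      case False
      then show ?thesis using Well_order_cases[OF wok, of \<xi> \<eta>] ij(1,2) by (auto simp: fK)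
    qed
    then show ?thesis using Rdisj[of "(\<xi>, i)" "(\<eta>, j)"] Rdisj[of "(\<eta>, j)" "(\<xi>, i)"] ij(3,4) by auto
  qed
  define Bad where "Bad \<eta> = {i \<in> ?M. \<not> |underS ?k \<eta>| \<le>o |A (\<eta>, i)|}" for \<eta>
  \<comment> \<open>Take \<open>x\<close> outside all sets \<open>A (\<xi>, j)\<close> with
    \<open>j \<in> ?M\<close> in layers up to \<open>\<eta>\<close> and outside their images. For
    each bad \<open>i\<close>, by maximality or by the exclusion of \<open>x\<close> from
    \<open>L\<close>, the set \<open>F x\<close> meets some \<open>A (\<xi>, i)\<close>;
    disjointness then embeds \<open>Bad \<eta>\<close> into \<open>F x\<close>.\<close>
  have Bad: "|Bad \<eta>| \<le>o r" if \<eta>: "\<eta> \<in> K" for \<eta>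
  proof -
    let ?S = "insert \<eta> (underS ?k \<eta>)"
    \<comment> \<open>For singular \<open>|K|\<close> it is not enough that each piece is smaller
      than \<open>|K|\<close>. The caps provide one bound \<open>|?N|\<close> below
      \<open>|K|\<close> for the number and the sizes of all pieces.\<close>
    let ?N = "underS ?k \<eta> <+> ?M"
    have infN: "infinite ?N" using infM by simp
    have uK: "|underS ?k \<eta>| <o ?k" using \<eta> by (intro card_of_underS[OF cK]) (simp add: fK)
    have NK: "|?N| <o ?k" by (rule card_of_Plus_ordLess_infinite[OF K(1) uK MK])
    have uN: "|underS ?k \<eta>| \<le>o |?N|" by (rule card_of_Plus1)
    have MN: "|?M| \<le>o |?N|" by (rule card_of_Plus2)
    have cN: "Cinfinite |?N|" using infN by (simp add: cinfinite_def Field_card_of card_of_card_order_on)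
    have SN: "|?S| \<le>o |?N|"
    proof -
      have "|{\<eta>}| \<le>o |?N|" using infM by (intro card_of_singl_ordLeq) auto
      from Un_Cinfinite_bound[OF this uN cN] show ?thesis by simp
    qed
    have rN: "r \<le>o |?N|"
    proof -
      have "t \<le>o |?M|"
        using ordLess_ordIso_trans[OF ts ordIso_symmetric[OF M]] by (rule ordLess_imp_ordLeq)
      then show ?thesis using ordLeq_transitive[OF rt ordLeq_transitive[OF _ MN]] by blast
    qed
    have under_mono: "underS ?k \<xi> \<subseteq> underS ?k \<eta>" if "\<xi> \<in> ?S" for \<xi>
      using that wok unfolding order_on_defs trans_def antisym_def underS_def by blast
    define U where "U = (\<Union>\<xi>\<in>?S. \<Union>j\<in>?M. A (\<xi>, j) \<union> (\<Union>a\<in>A (\<xi>, j). F a))"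
    have "|U| \<le>o |?N|"
      unfolding U_def
    proof (rule UNION_Cinfinite_bound[OF SN _ cN], rule ballI, rule UNION_Cinfinite_bound[OF MN _ cN], rule ballI)
      fix \<xi> j assume \<xi>: "\<xi> \<in> ?S" and "j \<in> ?M"
      have 1: "|A (\<xi>, j)| \<le>o |?N|"
        using ordLeq_transitive[OF Acard[of "(\<xi>, j)"]
            ordLeq_transitive[OF card_of_mono1 uN]] under_mono[OF \<xi>] by simp
      have "|F a| \<le>o |?N|" if "a \<in> A (\<xi>, j)" for a
        using ordLeq_transitive[OF F rN] AK that by blast
      then have "|\<Union>a\<in>A (\<xi>, j). F a| \<le>o |?N|" by (intro UNION_Cinfinite_bound[OF 1 _ cN]) blast
      then show "|A (\<xi>, j) \<union> (\<Union>a\<in>A (\<xi>, j). F a)| \<le>o |?N|" by (rule Un_Cinfinite_bound[OF 1 _ cN])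
    qed
    then have "|U| <o ?k" using NK by (rule ordLeq_ordLess_trans)
    then obtain x where x: "x \<in> K" "x \<notin> U"
      using card_of_mono1[of K U] not_ordLess_ordLeq[of "|U|" "|K|"] by blast
    have xA: "x \<notin> A (\<xi>, j)" "\<And>a. a \<in> A (\<xi>, j) \<Longrightarrow> x \<notin> F a" if "\<xi> \<in> ?S" "j \<in> ?M" for \<xi> j
      using x(2) that unfolding U_def by blast+
    have "\<exists>y. \<exists>\<xi>\<in>?S. y \<in> A (\<xi>, i) \<and> y \<in> F x" if i: "i \<in> Bad \<eta>" for i
    proof -
      have iM: "i \<in> ?M" using i by (simp add: Bad_def)
      show ?thesis
      proof (cases "x \<in> L A (\<eta>, i)")
        case True
        then have "x \<in> L A (\<eta>, i) - A (\<eta>, i)" using xA(1)[of \<eta> i] iM by blast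
        then have "\<not> free_set F (insert x (A (\<eta>, i)))"
          using Amax[of "(\<eta>, i)"] i unfolding Bad_def by auto
        from not_free_insert[OF Afree this] show ?thesis using xA(2)[of \<eta> i] iM by blast
      next
        case False
        have "x \<notin> prev A (\<eta>, i)"
        proof
          assume "x \<in> prev A (\<eta>, i)"
          then obtain \<xi> j where q: "((\<xi>, j), (\<eta>, i)) \<in> ?R" "j \<in> ?M" "x \<in> A (\<xi>, j)"
            unfolding prev_def by auto
          then have "\<xi> \<in> ?S" by (auto simp: underS_def)
          then show False using xA(1) q by blast
        qed
        then obtain \<xi> where "\<xi> \<in> underS ?k \<eta>" "\<not> (F x \<inter> A (\<xi>, i) = {} \<and> (\<forall>a\<in>A (\<xi>, i). x \<notin> F a))"
          using False x(1) unfolding L_def by auto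
        moreover from this(1) have "\<And>a. a \<in> A (\<xi>, i) \<Longrightarrow> x \<notin> F a" using xA(2) iM by blast
        ultimately show ?thesis by blast
      qed
    qed
    then have "\<exists>g. \<forall>i\<in>Bad \<eta>. \<exists>\<xi>\<in>?S. g i \<in> A (\<xi>, i) \<and> g i \<in> F x" by (intro bchoice ballI)
    then obtain g where g: "\<And>i. i \<in> Bad \<eta> \<Longrightarrow> \<exists>\<xi>\<in>?S. g i \<in> A (\<xi>, i) \<and> g i \<in> F x" by blast
    have SK: "?S \<subseteq> K" using \<eta> fK by (auto simp: underS_def Field_def)
    have "inj_on g (Bad \<eta>)"
    proof (rule inj_onI, rule ccontr)
      fix i j assume ij: "i \<in> Bad \<eta>" "j \<in> Bad \<eta>" "g i = g j" "i \<noteq> j"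
      obtain \<xi> where \<xi>: "\<xi> \<in> ?S" "g i \<in> A (\<xi>, i)" using g[OF ij(1)] by blast
      obtain \<zeta> where \<zeta>: "\<zeta> \<in> ?S" "g j \<in> A (\<zeta>, j)" using g[OF ij(2)] by blast
      have "A (\<xi>, i) \<inter> A (\<zeta>, j) = {}"
        using \<xi>(1) \<zeta>(1) SK ij by (intro disj) (auto simp: Bad_def)
      then show False using \<xi>(2) \<zeta>(2) ij(3) by auto
    qed
    then have "|Bad \<eta>| \<le>o |F x|" using g by (intro card_of_ordLeqI) blast+
    then show ?thesis using F[OF x(1)] by (rule ordLeq_transitive)
  qed
  have "|\<Union>\<eta>\<in>I. Bad \<eta>| \<le>o t"
    using ordLeq_transitive[OF Bad rt] I(1) by (intro UNION_Cinfinite_bound[OF It _ t]) blast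
  then have "|\<Union>\<eta>\<in>I. Bad \<eta>| <o |?M|"
    by (rule ordLeq_ordLess_trans[OF _ ordLess_ordIso_trans[OF ts ordIso_symmetric[OF M]]])
  then obtain i where i: "i \<in> ?M" "i \<notin> (\<Union>\<eta>\<in>I. Bad \<eta>)"
    using card_of_mono1[of ?M "\<Union>\<eta>\<in>I. Bad \<eta>"]
      not_ordLess_ordLeq[of "|\<Union>\<eta>\<in>I. Bad \<eta>|" "|?M|"] by blast
  then have full: "|underS ?k \<eta>| \<le>o |A (\<eta>, i)|" if "\<eta> \<in> I" for \<eta>
    using that unfolding Bad_def by blast
  define A' where "A' = (\<Union>\<eta>\<in>I. A (\<eta>, i))"
  have "free_set F A'"
    unfolding free_set_def
  proof (intro ballI impI)
    fix x y assume "x \<in> A'" "y \<in> A'" "x \<noteq> y"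
    then obtain \<xi> \<eta> where \<xi>: "\<xi> \<in> I" "x \<in> A (\<xi>, i)" and \<eta>: "\<eta> \<in> I" "y \<in> A (\<eta>, i)"
      unfolding A'_def by blast
    consider "\<xi> = \<eta>" | "\<xi> \<in> underS ?k \<eta>" | "\<eta> \<in> underS ?k \<xi>"
      using Well_order_cases[OF wok, of \<xi> \<eta>] \<xi> \<eta> I(1) by (auto simp: underS_def fK)
    then show "y \<notin> F x"
    proof cases
      case 1
      then show ?thesis using Afree[of "(\<eta>, i)"] \<xi> \<eta> \<open>x \<noteq> y\<close> unfolding free_set_def by blast
    next
      case 2
      then show ?thesis using AL[of "(\<eta>, i)"] \<xi> \<eta> unfolding L_def by auto
    next
      case 3
      then show ?thesis using AL[of "(\<xi>, i)"] \<xi> \<eta> unfolding L_def by fastforce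
    qed
  qed
  moreover have A'K: "A' \<subseteq> K" unfolding A'_def using AK by blast
  \<comment> \<open>Otherwise the segments below the elements of \<open>I\<close>, each no larger
    than \<open>A'\<close>, would cover \<open>K\<close> although both their number and their sizes
    are at most \<open>|A' <+> ?M|\<close>, which is below \<open>|K|\<close>.\<close>
  moreover have "|A'| =o ?k"
  proof (rule ccontr)
    assume "\<not> |A'| =o ?k"
    then have "|A'| <o ?k" using card_of_mono1[OF A'K] by (simp add: ordLeq_iff_ordLess_or_ordIso)
    then have NK: "|A' <+> ?M| <o ?k" by (rule card_of_Plus_ordLess_infinite[OF K(1) _ MK])
    have "K \<subseteq> (\<Union>\<eta>\<in>I. underS ?k \<eta>)"
      using I(2) unfolding cofinal_def fK underS_def by blast
    then have "?k \<le>o |\<Union>\<eta>\<in>I. underS ?k \<eta>|" by (rule card_of_mono1)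
    also have "|\<Union>\<eta>\<in>I. underS ?k \<eta>| \<le>o |A' <+> ?M|"
    proof (rule card_of_UNION_ordLeq_infinite)
      show "infinite (A' <+> ?M)" using infM by simp
      have "|I| \<le>o |?M|"
        using ordLeq_ordLess_trans[OF It ordLess_ordIso_trans[OF ts ordIso_symmetric[OF M]]]
        by (rule ordLess_imp_ordLeq)
      then show "|I| \<le>o |A' <+> ?M|" by (rule ordLeq_transitive[OF _ card_of_Plus2])
      show "\<forall>\<eta>\<in>I. |underS ?k \<eta>| \<le>o |A' <+> ?M|"
      proof
        fix \<eta> assume \<eta>: "\<eta> \<in> I"
        then have "A (\<eta>, i) \<subseteq> A'" unfolding A'_def by blast
        then show "|underS ?k \<eta>| \<le>o |A' <+> ?M|"
          by (intro ordLeq_transitive[OF full[OF \<eta>] ordLeq_transitive[OF card_of_mono1 card_of_Plus1]])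
      qed
    qed
    finally show False using NK not_ordLess_ordLeq[of "|A' <+> ?M|" ?k] by blast
  qed
  ultimately show ?thesis by blast
qed

text \<open>This is Hajnal's free set theorem, assembled from the regular and the singular
  case.\<close>

lemma free_set_exists:
  assumes K: "infinite K" and r: "Cinfinite r" "cardSuc r <o |K|"
    and F: "\<And>x. x \<in> K \<Longrightarrow> |F x| \<le>o r"
  shows "\<exists>A\<subseteq>K. |A| =o |K| \<and> free_set F A"
proof (cases "regularCard |K|")
  case True
  then have "stable |K|"
    using K by (intro regularCard_stable) (simp_all add: Field_card_of card_of_card_order_on)
  from free_set_regular[OF K this r F] show ?thesis .
next
  case False
  have "r <o |K|" using r(1) by (intro ordLess_transitive[OF cardSuc_greater r(2)]) simp
  from free_set_singular[OF K False r(1) this F] show ?thesis .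
qed

section \<open>Extending small filters\<close>

text \<open>The set is closed. A basic open set restricts finitely many coordinates, so any of its
  points can be changed at a free coordinate \<open>i\<close> to a value \<open>v\<close> with
  \<open>(i, v) \<in> D\<close>, which leads out of the set.\<close>

lemma nowhere_dense_avoiding:
  fixes D :: "(nat \<times> nat) set"
  assumes "infinite (fst ` D)"
  shows "nowhere_dense {h. \<forall>(i, v)\<in>D. h i \<noteq> v}"
proof -
  let ?N = "{h. \<forall>(i, v)\<in>D. h i \<noteq> v}"
  have "open ((\<lambda>h::nat \<Rightarrow> nat. h i) -` {v})" for i v
    by (intro open_vimage open_discrete continuous_on_product_coordinates)
  then have "closed (\<Inter>p\<in>D. - ((\<lambda>h::nat \<Rightarrow> nat. h (fst p)) -` {snd p}))"
    by (intro closed_INT ballI closed_Compl)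
  also have "(\<Inter>p\<in>D. - ((\<lambda>h::nat \<Rightarrow> nat. h (fst p)) -` {snd p})) = ?N"
    by (intro set_eqI) (simp add: split_beta)
  finally have "closure ?N = ?N" by (rule closure_closed)
  moreover have "interior ?N = {}"
  proof (rule ccontr)
    assume "interior ?N \<noteq> {}"
    then obtain g where g: "g \<in> interior ?N" by blast
    have "openin (product_topology (\<lambda>i. euclidean) UNIV) (interior ?N)"
      using open_interior[of ?N] by (simp add: open_fun_def)
    from product_topology_open_contains_basis[OF this g]
    obtain X where X: "g \<in> (\<Pi>\<^sub>E i\<in>UNIV. X i)" "finite {i. X i \<noteq> topspace euclidean}"
      "(\<Pi>\<^sub>E i\<in>UNIV. X i) \<subseteq> interior ?N" by blast
    have "infinite (fst ` D - {i. X i \<noteq> topspace euclidean})"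
      using assms X(2) by (simp add: Diff_infinite_finite)
    then obtain i where "i \<in> fst ` D - {i. X i \<noteq> topspace euclidean}"
      using infinite_imp_nonempty by blast
    then obtain v where v: "(i, v) \<in> D" "X i = UNIV" by auto
    have "g(i := v) \<in> (\<Pi>\<^sub>E i\<in>UNIV. X i)" using X(1) v(2) by (auto simp: PiE_iff)
    then have "g(i := v) \<in> ?N" using X(3) interior_subset by blast
    then show False using v(1) by auto
  qed
  ultimately show ?thesis by (simp add: nowhere_dense_def)
qed

text \<open>Otherwise the nowhere dense sets of functions missing some \<open>D\<close> would cover
  Baire space with fewer than continuum many meager sets.\<close>

lemma cov_meager_generic:
  fixes \<D> :: "(nat \<times> nat) set set"
  assumes cov: "cov_meager =o continuum" and \<D>: "|\<D>| <o continuum"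
    and inf: "\<And>D. D \<in> \<D> \<Longrightarrow> infinite (fst ` D)"
  shows "\<exists>h. \<forall>D\<in>\<D>. \<exists>(i, v)\<in>D. h i = v"
proof (rule ccontr)
  assume no: "\<not> ?thesis"
  let ?N = "\<lambda>D. {h :: nat \<Rightarrow> nat. \<forall>(i, v)\<in>D. h i \<noteq> v}"
  let ?cov = "{\<C> :: (nat \<Rightarrow> nat) set set. (\<forall>M\<in>\<C>. meager M) \<and> \<Union>\<C> = UNIV}"
  have "meager (?N D)" if "D \<in> \<D>" for D
    unfolding meager_def using nowhere_dense_avoiding[OF inf[OF that]]
    by (intro exI[of _ "{?N D}"]) simp
  moreover have "\<Union>(?N ` \<D>) = UNIV"
  proof (rule set_eqI)
    fix h :: "nat \<Rightarrow> nat"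
    obtain D where "D \<in> \<D>" "\<not> (\<exists>(i, v)\<in>D. h i = v)" using no by blast
    then have "h \<in> ?N D" by auto
    with \<open>D \<in> \<D>\<close> show "h \<in> \<Union>(?N ` \<D>) \<longleftrightarrow> h \<in> UNIV" by blast
  qed
  ultimately have mem: "?N ` \<D> \<in> ?cov" by blast
  then have "?cov \<noteq> {}" by blast
  from least_card_attained[OF this] have "cov_meager \<le>o |?N ` \<D>|"
    using mem unfolding cov_meager_def by auto
  then have "cov_meager \<le>o |\<D>|" using card_of_image by (rule ordLeq_transitive)
  then have "cov_meager <o continuum" using \<D> by (rule ordLeq_ordLess_trans)
  then show False using cov not_ordLess_ordIso by blast
qed

lemma small_filter_base:
  assumes "small_filter F"
  shows "\<exists>\<B>. filter_base \<B> F \<and> |\<B>| <o continuum \<and>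
    (\<forall>A\<in>\<B>. A \<in> filter_sets F) \<and> (\<forall>A\<in>\<B>. infinite A)"
proof -
  obtain \<B> where \<B>: "filter_base \<B> F" "|\<B>| <o continuum"
    using assms unfolding small_filter_def by blast
  moreover have sets: "A \<in> filter_sets F" if "A \<in> \<B>" for A
    using \<B>(1) that by (auto simp: filter_base_def)
  moreover have "infinite A" if "A \<in> \<B>" for A
    using assms sets[OF that] unfolding small_filter_def filter_sets_def
    by (intro frequently_infinite[of F] eventually_frequently) auto
  ultimately show ?thesis by (intro exI[of _ \<B>] conjI ballI)
qed

text \<open>A generic \<open>h\<close> takes both values 0 and 1 on every base set, so its zero set
  splits the filter.\<close>

lemma small_filter_split_cov_meager:
  assumes "cov_meager =o continuum" "small_filter F"
  shows "\<exists>E. (\<exists>\<^sub>F x in F. x \<in> E) \<and> (\<exists>\<^sub>F x in F. x \<notin> E)"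
proof -
  obtain \<B> where \<B>: "filter_base \<B> F" "|\<B>| <o continuum" "\<forall>A\<in>\<B>. A \<in> filter_sets F"
    "\<forall>A\<in>\<B>. infinite A"
    using small_filter_base[OF assms(2)] by (elim exE conjE)
  define \<D> where "\<D> = (\<lambda>A. A \<times> {0::nat}) ` \<B> \<union> (\<lambda>A. A \<times> {1}) ` \<B>"
  have "|\<D>| <o continuum"
    unfolding \<D>_def
    by (rule Un_Cinfinite_bound_strict[OF ordLeq_ordLess_trans[OF card_of_image \<B>(2)]
          ordLeq_ordLess_trans[OF card_of_image \<B>(2)] Cinfinite_continuum])
  moreover have "infinite (fst ` D)" if D: "D \<in> \<D>" for D
  proof -
    obtain A i where "A \<in> \<B>" "D = A \<times> {i}" using D by (auto simp: \<D>_def)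
    then show ?thesis using \<B>(4) by simp
  qed
  ultimately have "\<exists>h. \<forall>D\<in>\<D>. \<exists>(i, v)\<in>D. h i = v"
    by (rule cov_meager_generic[OF assms(1)])
  then obtain h where h: "\<forall>D\<in>\<D>. \<exists>(i, v)\<in>D. h i = v" ..
  have "A \<inter> {n. h n = 0} \<noteq> {}" "A \<inter> - {n. h n = 0} \<noteq> {}" if "A \<in> \<B>" for A
    using that h[THEN bspec, of "A \<times> {0}"] h[THEN bspec, of "A \<times> {1}"] by (auto simp: \<D>_def)
  then have "(\<exists>\<^sub>F x in F. x \<in> {n. h n = 0}) \<and> (\<exists>\<^sub>F x in F. x \<in> - {n. h n = 0})"
    unfolding frequently_filter_base[OF \<B>(1)] by blast
  then show ?thesis by (intro exI[of _ "{n. h n = 0}"]) simp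
qed

text \<open>Were the image finite, \<open>A\<close> would be covered by finitely many fibres, one of
  which would be positive.\<close>

lemma fibres_infinite_image:
  assumes "F \<noteq> bot" "\<And>n. \<not> (\<exists>\<^sub>F x in F. f x = n)" "A \<in> filter_sets F"
  shows "infinite (f ` A)"
proof
  assume fin: "finite (f ` A)"
  have "\<forall>\<^sub>F x in F. \<exists>n\<in>f ` A. f x = n"
    using assms(3) unfolding filter_sets_def by (auto elim: eventually_mono)
  then have "\<exists>\<^sub>F x in F. \<exists>n\<in>f ` A. f x = n"
    using assms(1) by (intro eventually_frequently)
  from frequently_bex_finite[OF fin this] assms(2) show False by blast
qed

text \<open>
  When no fibre of \<open>f\<close> is positive, a sufficiently generic partial section of \<open>f\<close> is the set required.
\<close>

lemma small_filter_selective_set: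
  fixes f :: "nat \<Rightarrow> nat"
  assumes "cov_meager =o continuum" "small_filter F"
  shows "\<exists>X. (\<exists>\<^sub>F x in F. x \<in> X) \<and> (f constant_on X \<or> inj_on f X)"
proof (cases "\<exists>n. \<exists>\<^sub>F x in F. f x = n")
  case True
  then obtain n where "\<exists>\<^sub>F x in F. x \<in> {x. f x = n}" by auto
  moreover have "f constant_on {x. f x = n}" by (auto simp: constant_on_def)
  ultimately show ?thesis by blast
next
  case False
  obtain \<B> where \<B>: "filter_base \<B> F" "|\<B>| <o continuum" "\<forall>A\<in>\<B>. A \<in> filter_sets F"
    "\<forall>A\<in>\<B>. infinite A"
    using small_filter_base[OF assms(2)] by (elim exE conjE)
  \<comment> \<open>Meeting such a set means \<open>h (f a) = a\<close> for some
    \<open>a \<in> A\<close>: \<open>h\<close> picks from the fibre of \<open>a\<close> the point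
    \<open>a\<close> itself.\<close>
  define \<D> where "\<D> = (\<lambda>A. (\<lambda>a. (f a, a)) ` A) ` \<B>"
  have "|\<D>| <o continuum"
    unfolding \<D>_def by (rule ordLeq_ordLess_trans[OF card_of_image \<B>(2)])
  moreover have "infinite (fst ` D)" if D: "D \<in> \<D>" for D
  proof -
    obtain A where A: "A \<in> \<B>" "D = (\<lambda>a. (f a, a)) ` A" using D by (auto simp: \<D>_def)
    have "infinite (f ` A)"
      using False assms(2) bspec[OF \<B>(3) A(1)] by (intro fibres_infinite_image) (auto simp: small_filter_def)
    then show ?thesis by (simp add: A(2) image_image)
  qed
  ultimately have "\<exists>h. \<forall>D\<in>\<D>. \<exists>(i, v)\<in>D. h i = v"
    by (rule cov_meager_generic[OF assms(1)])
  then obtain h where h: "\<forall>D\<in>\<D>. \<exists>(i, v)\<in>D. h i = v" ..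
  let ?X = "{x. h (f x) = x}"
  have "A \<inter> ?X \<noteq> {}" if "A \<in> \<B>" for A
    using that h[THEN bspec, of "(\<lambda>a. (f a, a)) ` A"] by (auto simp: \<D>_def)
  then have "\<exists>\<^sub>F x in F. x \<in> ?X" unfolding frequently_filter_base[OF \<B>(1)] by blast
  moreover have "inj_on f ?X" by (rule inj_on_inverseI[of _ h]) simp
  ultimately show ?thesis by blast
qed

section \<open>Positive sets when \<open>dominating_number\<close> and
  \<open>ultrafilter_number\<close> equal the continuum\<close>

lemma small_filter_split_ultrafilter_number:
  assumes u: "ultrafilter_number =o continuum" and F: "small_filter F"
  shows "\<exists>E. (\<exists>\<^sub>F x in F. x \<in> E) \<and> (\<exists>\<^sub>F x in F. x \<notin> E)"
proof (rule ccontr)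
  assume "\<not> ?thesis"
  then have "nonprincipal_ultrafilter F"
    using F by (intro nonprincipal_ultrafilterI) (auto simp: small_filter_def frequently_def)
  moreover obtain \<B> where \<B>: "filter_base \<B> F" "|\<B>| <o continuum"
    using F unfolding small_filter_def by blast
  ultimately have mem: "\<B> \<in> {\<B>. \<exists>U. nonprincipal_ultrafilter U \<and> filter_base \<B> U}" by blast
  then have "{\<B>. \<exists>U. nonprincipal_ultrafilter U \<and> filter_base \<B> U} \<noteq> {}" by blast
  from least_card_attained[OF this] have "ultrafilter_number \<le>o |\<B>|"
    using mem unfolding ultrafilter_number_def by auto
  then have "ultrafilter_number <o continuum" using \<B>(2) by (rule ordLeq_ordLess_trans)
  then show False using u not_ordLess_ordIso by blast
qed

text \<open>If no fibre is positive, let \<open>e A n\<close> be the least point of \<open>A\<close>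
  with value at least \<open>n\<close>. A function \<open>g\<close> that is eventually below none of
  the \<open>e A\<close>, replaced by its running maximum \<open>h\<close>, makes
  \<open>{k. k \<le> h (f k)}\<close> meet every \<open>A\<close>, and its fibre over
  \<open>n\<close> is bounded by \<open>h n\<close>.\<close>

lemma small_filter_finite_to_one_set:
  fixes f :: "nat \<Rightarrow> nat"
  assumes d: "dominating_number =o continuum" and F: "small_filter F"
  shows "\<exists>X. (\<exists>\<^sub>F x in F. x \<in> X) \<and> (f constant_on X \<or> (\<forall>n. finite {x\<in>X. f x = n}))"
proof (cases "\<exists>n. \<exists>\<^sub>F x in F. f x = n")
  case True
  then obtain n where "\<exists>\<^sub>F x in F. x \<in> {x. f x = n}" by auto
  moreover have "f constant_on {x. f x = n}" by (auto simp: constant_on_def)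
  ultimately show ?thesis by blast
next
  case False
  obtain \<B> where \<B>: "filter_base \<B> F" "|\<B>| <o continuum" "\<forall>A\<in>\<B>. A \<in> filter_sets F"
    "\<forall>A\<in>\<B>. infinite A"
    using small_filter_base[OF F] by (elim exE conjE)
  have ex: "\<exists>k. k \<in> A \<and> n \<le> f k" if "A \<in> \<B>" for A n
  proof (rule ccontr)
    assume "\<not> ?thesis"
    then have "f ` A \<subseteq> {..<n}" by force
    then have "finite (f ` A)" by (rule finite_subset) simp
    moreover have "infinite (f ` A)"
      using False F bspec[OF \<B>(3) that] by (intro fibres_infinite_image) (auto simp: small_filter_def)
    ultimately show False by simp
  qed
  define e where "e A n = (LEAST k. k \<in> A \<and> n \<le> f k)" for A n
  have e: "e A n \<in> A" "n \<le> f (e A n)" if "A \<in> \<B>" for A n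
    using LeastI_ex[OF ex[OF that]] unfolding e_def by blast+
  have "\<not> dominating (e ` \<B>)"
  proof
    assume "dominating (e ` \<B>)"
    then have mem: "e ` \<B> \<in> {D. dominating D}" by simp
    then have "{D. dominating D} \<noteq> {}" by blast
    from least_card_attained[OF this] have "dominating_number \<le>o |e ` \<B>|"
      using mem unfolding dominating_number_def by auto
    then have "dominating_number \<le>o |\<B>|" using card_of_image by (rule ordLeq_transitive)
    then have "dominating_number <o continuum" using \<B>(2) by (rule ordLeq_ordLess_trans)
    then show False using d not_ordLess_ordIso by blast
  qed
  then obtain g where g: "\<forall>A\<in>\<B>. \<not> (\<forall>\<^sub>F n in sequentially. g n \<le> e A n)"
    unfolding dominating_def by auto
  \<comment> \<open>Monotonicity matters because \<open>f (e A n)\<close> may exceed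
    \<open>n\<close>.\<close>
  define h where "h n = Max (g ` {..n})" for n
  have gh: "g m \<le> h n" if "m \<le> n" for m n
    unfolding h_def using that by (intro Max_ge) auto
  let ?X = "{k. k \<le> h (f k)}"
  have "A \<inter> ?X \<noteq> {}" if A: "A \<in> \<B>" for A
  proof -
    have "\<exists>n. e A n < g n"
      using bspec[OF g A] by (meson always_eventually not_le)
    then obtain n where "e A n < g n" ..
    also have "g n \<le> h (f (e A n))" by (rule gh[OF e(2)[OF A]])
    finally show ?thesis using e(1)[OF A] by (intro ex_in_conv[THEN iffD1] exI[of _ "e A n"]) simp
  qed
  then have "\<exists>\<^sub>F x in F. x \<in> ?X" unfolding frequently_filter_base[OF \<B>(1)] by blast
  moreover have "finite {x\<in>?X. f x = n}" for n
    by (rule finite_subset[of _ "{..h n}"]) auto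
  ultimately show ?thesis by blast
qed

section \<open>Incomparable families\<close>

abbreviation tukey_below :: "nat filter \<Rightarrow> nat filter \<Rightarrow> bool" where
  "tukey_below U V \<equiv> tukey_le (filter_sets U) (\<supseteq>) (filter_sets V) (\<supseteq>)"

lemma card_tukey_below:
  assumes "p_point V"
  shows "|{U. tukey_below U V}| \<le>o continuum"
proof -
  \<comment> \<open>For maps \<open>f\<close> that reduce no ultrafilter to \<open>V\<close> the
    value of \<open>THE\<close> may be arbitrary; only an inclusion is claimed.\<close>
  have "{U. tukey_below U V} \<subseteq> (\<lambda>f. THE U. cofinal_map f V U) ` Collect monotone_continuous"
  proof
    fix U assume "U \<in> {U. tukey_below U V}"
    then obtain f where f: "monotone_continuous f" "cofinal_map f V U"
      using p_point_tukey_le[OF assms] by blast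
    have "(THE U. cofinal_map f V U) = U"
      using f(2) by (rule the_equality) (rule cofinal_map_determines[OF _ f(2)])
    then show "U \<in> (\<lambda>f. THE U. cofinal_map f V U) ` Collect monotone_continuous"
      using f(1) by (intro image_eqI[of _ _ f]) auto
  qed
  from card_of_mono1[OF this] show ?thesis
    by (rule ordLeq_transitive[OF _ card_of_image_continuum[OF card_monotone_continuous]])
qed

text \<open>A characteristic function has two values, so it is not finite-to-one on the infinite set
  \<open>Y\<close>; being constant there, it puts \<open>Y\<close> inside \<open>X\<close> or its
  complement. Thus the requirements on functions already make \<open>V\<close> an
  ultrafilter.\<close>

lemma two_valued_ultrafilter:
  assumes V: "V \<noteq> bot" "V \<le> cofinite"
    and ftt: "\<And>f :: nat \<Rightarrow> nat. \<exists>X\<in>filter_sets V. f constant_on X \<or> (\<forall>n. finite {x\<in>X. f x = n})"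
  shows "nonprincipal_ultrafilter V"
proof (rule nonprincipal_ultrafilterI[OF V])
  fix X :: "nat set"
  let ?f = "\<lambda>x. if x \<in> X then 1 else 0 :: nat"
  obtain Y where Y: "Y \<in> filter_sets V" "?f constant_on Y \<or> (\<forall>n. finite {x\<in>Y. ?f x = n})"
    using ftt[of ?f] by (elim bexE)
  have "infinite Y"
    using Y(1) V by (intro frequently_infinite[of V] eventually_frequently) (auto simp: filter_sets_def)
  moreover have "Y \<subseteq> {x\<in>Y. ?f x = 0} \<union> {x\<in>Y. ?f x = 1}" by auto
  ultimately have "\<not> (\<forall>n. finite {x\<in>Y. ?f x = n})" using finite_subset finite_UnI by blast
  with Y(2) have "?f constant_on Y" by (simp only: simp_thms)
  then obtain c where c: "\<forall>x\<in>Y. ?f x = c" unfolding constant_on_def ..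
  have "Y \<subseteq> X \<or> Y \<subseteq> - X"
  proof (cases "c = 1")
    case True
    then have "Y \<subseteq> X" using c by (auto split: if_splits)
    then show ?thesis ..
  next
    case False
    then have "Y \<subseteq> - X" using c by auto
    then show ?thesis ..
  qed
  then show "(\<forall>\<^sub>F x in V. x \<in> X) \<or> (\<forall>\<^sub>F x in V. x \<notin> X)"
    using filter_sets_mono[OF Y(1), of X] filter_sets_mono[OF Y(1), of "- X"]
    by (auto simp: filter_sets_def)
qed

text \<open>
  The predicate \<open>Q\<close> covers both parts of the theorem: \<open>Q f X\<close> says that \<open>f\<close> is constant or
  one-to-one on \<open>X\<close> for selective ultrafilters, constant or finite-to-one for p-points.
\<close>

locale extendible_small_filters =
  fixes Q :: "(nat \<Rightarrow> nat) \<Rightarrow> nat set \<Rightarrow> bool"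
  assumes split: "small_filter F \<Longrightarrow> \<exists>E. (\<exists>\<^sub>F x in F. x \<in> E) \<and> (\<exists>\<^sub>F x in F. x \<notin> E)"
    and extend: "small_filter F \<Longrightarrow> \<exists>X. (\<exists>\<^sub>F x in F. x \<in> X) \<and> Q f X"
    and finite_to_one: "Q f X \<Longrightarrow> f constant_on X \<or> (\<forall>n. finite {x\<in>X. f x = n})"
begin

definition good :: "nat filter \<Rightarrow> bool" where
  "good V \<longleftrightarrow> nonprincipal_ultrafilter V \<and> (\<forall>f. \<exists>X\<in>filter_sets V. Q f X)"

lemma good_p_point: "good V \<Longrightarrow> p_point V"
  unfolding good_def using finite_to_one by (intro p_pointI) blast+

text \<open>The tree meets continuum many requirements: \<open>Tq f\<close> puts a set with
  \<open>Q f\<close> into the filter, and \<open>Tu (f, U)\<close> bars \<open>f\<close> from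
  reducing \<open>U\<close>. As the resulting ultrafilters are p-points, barring continuous maps
  bars every Tukey reduction.\<close>

lemma many_good_not_above:
  assumes W: "|W| \<le>o continuum" "\<And>U. U \<in> W \<Longrightarrow> nonprincipal_ultrafilter U"
  shows "\<exists>V :: ((nat \<Rightarrow> bool) \<Rightarrow> bool) \<Rightarrow> nat filter. inj V \<and>
    (\<forall>x. good (V x) \<and> (\<forall>U\<in>W. \<not> tukey_below U (V x)))"
proof -
  define Tq where "Tq f = {F. \<exists>X. X \<in> filter_sets F \<and> Q f X}" for f
  define Tu where "Tu = (\<lambda>(f, U). {F. \<forall>V. nonprincipal_ultrafilter V \<and> V \<le> F \<longrightarrow> \<not> cofinal_map f V U})"
  define \<T> where "\<T> = range Tq \<union> Tu ` (Collect monotone_continuous \<times> W)"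
  have "inj_on (\<lambda>f :: nat \<Rightarrow> nat. {(n, k). k = f n}) UNIV"
    by (auto simp: inj_on_def set_eq_iff fun_eq_iff)
  then have "|UNIV :: (nat \<Rightarrow> nat) set| \<le>o continuum" by (rule card_of_countable_subsets)
  then have "|range Tq| \<le>o continuum" by (rule card_of_image_continuum)
  moreover have "|Collect monotone_continuous \<times> W| \<le>o continuum"
    using Cinfinite_continuum card_monotone_continuous W(1)
    by (intro card_of_Times_ordLeq_infinite_Field) (simp_all add: cinfinite_def)
  then have "|Tu ` (Collect monotone_continuous \<times> W)| \<le>o continuum"
    by (rule card_of_image_continuum)
  ultimately have "|\<T>| \<le>o continuum"
    unfolding \<T>_def using Cinfinite_continuum by (rule Un_Cinfinite_bound)
  moreover have "\<T> \<noteq> {}" by (auto simp: \<T>_def)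
  ultimately obtain T :: "(nat \<Rightarrow> bool) \<Rightarrow> nat filter set" where T: "range T = \<T>"
    using card_of_ordLeq2[of \<T> "UNIV :: (nat \<Rightarrow> bool) set"] unfolding continuum_eq by blast
  have dense: "\<exists>X. (\<exists>\<^sub>F x in F. x \<in> X) \<and> inf F (principal X) \<in> T \<alpha>" if F: "small_filter F" for F \<alpha>
  proof -
    have "T \<alpha> \<in> \<T>" using T by blast
    then consider f where "T \<alpha> = Tq f"
      | f U where "T \<alpha> = Tu (f, U)" "monotone_continuous f" "U \<in> W"
      unfolding \<T>_def by blast
    then show ?thesis
    proof cases
      case 1
      obtain X where "\<exists>\<^sub>F x in F. x \<in> X" "Q f X" using extend[OF F] by blast
      moreover have "X \<in> filter_sets (inf F (principal X))"
        by (simp add: filter_sets_def eventually_inf_principal)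
      ultimately show ?thesis unfolding 1 Tq_def by blast
    next
      case 2
      show ?thesis
        using small_filter_avoid_cofinal_map[OF split F 2(2) W(2)[OF 2(3)]]
        unfolding 2(1) Tu_def by simp
    qed
  qed
  have "\<exists>V :: ((nat \<Rightarrow> bool) \<Rightarrow> bool) \<Rightarrow> nat filter. inj V \<and>
    (\<forall>x. V x \<noteq> bot \<and> V x \<le> cofinite \<and> (\<forall>\<alpha>. \<exists>F\<in>T \<alpha>. V x \<le> F))"
    by (rule generic_tree[of T]) (erule split, erule dense)
  then obtain V :: "((nat \<Rightarrow> bool) \<Rightarrow> bool) \<Rightarrow> nat filter" where V: "inj V"
    "\<forall>x. V x \<noteq> bot \<and> V x \<le> cofinite \<and> (\<forall>\<alpha>. \<exists>F\<in>T \<alpha>. V x \<le> F)" by (elim exE conjE)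
  have meets: "\<exists>F\<in>\<S>. V x \<le> F" if "\<S> \<in> \<T>" for x \<S>
    using V(2) that unfolding T[symmetric] by blast
  have Q: "\<exists>X\<in>filter_sets (V x). Q f X" for x f
  proof -
    have "Tq f \<in> \<T>" by (simp add: \<T>_def)
    then obtain F X where "V x \<le> F" "X \<in> filter_sets F" "Q f X"
      using meets[of "Tq f" x] unfolding Tq_def by blast
    moreover from this have "X \<in> filter_sets (V x)" by (auto simp: filter_sets_def intro: filter_leD)
    ultimately show ?thesis by blast
  qed
  have ultra: "nonprincipal_ultrafilter (V x)" for x
    using V(2) Q[of x] finite_to_one by (intro two_valued_ultrafilter) blast+
  have good: "good (V x)" for x using ultra Q by (simp add: good_def)
  have "\<not> tukey_below U (V x)" if U: "U \<in> W" for U x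
  proof
    assume "tukey_below U (V x)"
    then obtain f where f: "monotone_continuous f" "cofinal_map f (V x) U"
      using p_point_tukey_le[OF good_p_point[OF good]] by blast
    have "Tu (f, U) \<in> \<T>" using f(1) U by (auto simp: \<T>_def)
    from meets[OF this, of x] show False using f(2) ultra by (auto simp: Tu_def)
  qed
  with V(1) good show ?thesis by blast
qed

lemma incomparable_family:
  "\<exists>S. |S| =o ctwo ^c continuum \<and> (\<forall>V\<in>S. good V) \<and> pairwise tukey_incomparable S"
proof (cases "cardSuc continuum <o |UNIV :: ((nat \<Rightarrow> bool) \<Rightarrow> bool) set|")
  case True
  obtain V :: "((nat \<Rightarrow> bool) \<Rightarrow> bool) \<Rightarrow> nat filter" where V: "inj V" "\<And>x. good (V x)"
    using many_good_not_above[of "{}"] card_countable_continuum[of "{}"] ordLess_imp_ordLeq by auto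
  have iso: "|UNIV :: ((nat \<Rightarrow> bool) \<Rightarrow> bool) set| =o |range V|"
    using V(1) by (intro card_of_ordIsoI[of V]) (simp add: bij_betw_def)
  have "continuum <o |range V|" using continuum_ordLess iso by (rule ordLess_ordIso_trans)
  then have "infinite (range V)"
    using cinfinite_mono[OF ordLess_imp_ordLeq, of continuum "|range V|"] Cinfinite_continuum
    unfolding cinfinite_def Field_card_of by blast
  moreover have "cardSuc continuum <o |range V|" using True iso by (rule ordLess_ordIso_trans)
  moreover have "|{U. tukey_below U X}| \<le>o continuum" if "X \<in> range V" for X
    using that V(2) by (intro card_tukey_below good_p_point) auto
  ultimately obtain A where A: "A \<subseteq> range V" "|A| =o |range V|" "free_set (\<lambda>X. {U. tukey_below U X}) A"
    using free_set_exists[OF _ Cinfinite_continuum, of "range V" "\<lambda>X. {U. tukey_below U X}"] by blast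
  have "|A| =o ctwo ^c continuum"
    unfolding ctwo_cexp_continuum by (rule ordIso_transitive[OF A(2) ordIso_symmetric[OF iso]])
  moreover have "\<forall>X\<in>A. good X" using A(1) V(2) by blast
  moreover have "pairwise tukey_incomparable A"
  proof (rule pairwiseI)
    fix X Y assume "X \<in> A" "Y \<in> A" "X \<noteq> Y"
    then have "Y \<notin> {U. tukey_below U X}" "X \<notin> {U. tukey_below U Y}"
      using A(3)[unfolded free_set_def, THEN bspec, THEN bspec] by simp_all
    then show "tukey_incomparable X Y" by (simp add: tukey_incomparable_def)
  qed
  ultimately show ?thesis by blast
next
  case False
  let ?k = "|UNIV :: ((nat \<Rightarrow> bool) \<Rightarrow> bool) set|"
  have wo: "Well_order ?k" by (rule card_of_Well_order)
  have wf: "wf (?k - Id)" using wo by (simp add: well_order_on_def Field_card_of)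
  have cs: "Card_order (cardSuc continuum)" by (rule cardSuc_Card_order[OF Card_order_continuum])
  \<comment> \<open>Hence each stage of the recursion along \<open>?k\<close> has at most continuum
    many predecessors.\<close>
  have le: "?k \<le>o cardSuc continuum"
    using False not_ordLess_iff_ordLeq[OF wo card_order_on_well_order_on[OF cs]] by blast
  define P where "P f x v \<longleftrightarrow> good v \<and>
    (\<forall>y\<in>underS ?k x. \<not> tukey_below (f y) v \<and> \<not> tukey_below v (f y) \<and> v \<noteq> f y)" for f x v
  have "\<exists>V. \<forall>x. P V x (V x)"
  proof (rule dependent_wf_choice[OF wf])
    fix f g :: "((nat \<Rightarrow> bool) \<Rightarrow> bool) \<Rightarrow> nat filter" and x v
    assume "\<And>z. (z, x) \<in> ?k - Id \<Longrightarrow> f z = g z"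
    then have "\<forall>y\<in>underS ?k x. f y = g y" by (simp add: underS_def)
    then show "P f x v = P g x v" unfolding P_def by simp
  next
    fix x and f :: "((nat \<Rightarrow> bool) \<Rightarrow> bool) \<Rightarrow> nat filter"
    assume IH: "\<And>y. (y, x) \<in> ?k - Id \<Longrightarrow> P f y (f y)"
    define W where "W = f ` underS ?k x"
    have W: "good U" if "U \<in> W" for U
      using that IH unfolding W_def P_def underS_def by blast
    have "|underS ?k x| <o ?k" by (rule card_of_underS[OF card_of_Card_order]) (simp add: Field_card_of)
    then have "|underS ?k x| <o cardSuc continuum" using le by (rule ordLess_ordLeq_trans)
    then have "|underS ?k x| \<le>o continuum"
      using cardSuc_ordLeq_ordLess[OF Card_order_continuum card_of_Card_order] by blast
    then have cW: "|W| \<le>o continuum" unfolding W_def by (rule card_of_image_continuum)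
    have "\<exists>V :: ((nat \<Rightarrow> bool) \<Rightarrow> bool) \<Rightarrow> nat filter. inj V \<and>
        (\<forall>x. good (V x) \<and> (\<forall>U\<in>W. \<not> tukey_below U (V x)))"
      using W by (intro many_good_not_above[OF cW]) (simp add: good_def)
    then obtain V :: "((nat \<Rightarrow> bool) \<Rightarrow> bool) \<Rightarrow> nat filter"
      where V: "inj V" "\<And>z. good (V z)" "\<And>z U. U \<in> W \<Longrightarrow> \<not> tukey_below U (V z)" by blast
    \<comment> \<open>\<open>Z\<close> holds the ultrafilters already chosen and those below them.
      It is too small to contain all of the \<open>V z\<close>, none of which is above a chosen
      one.\<close>
    define Z where "Z = W \<union> (\<Union>U\<in>W. {v. tukey_below v U})"
    have "|Z| \<le>o continuum"
      unfolding Z_def using card_tukey_below[OF good_p_point[OF W]]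
      by (intro Un_Cinfinite_bound UNION_Cinfinite_bound cW Cinfinite_continuum) blast
    then have "|Z| <o ?k" using continuum_ordLess by (rule ordLeq_ordLess_trans)
    moreover have "?k =o |range V|"
      using V(1) by (intro card_of_ordIsoI[of V]) (simp add: bij_betw_def)
    ultimately have "|Z| <o |range V|" by (rule ordLess_ordIso_trans)
    then obtain v where v: "v \<in> range V" "v \<notin> Z"
      using card_of_mono1[of "range V" Z] not_ordLess_ordLeq[of "|Z|" "|range V|"] by blast
    have "P f x v"
      unfolding P_def
    proof (intro conjI ballI)
      show "good v" using v(1) V(2) by blast
      fix y assume "y \<in> underS ?k x"
      then have y: "f y \<in> W" by (simp add: W_def)
      show "\<not> tukey_below (f y) v" using v(1) V(3)[OF y] by blast
      show "\<not> tukey_below v (f y)" "v \<noteq> f y" using v(2) y unfolding Z_def by blast+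
    qed
    then show "\<exists>v. P f x v" ..
  qed
  then obtain V where V: "\<And>x. P V x (V x)" by blast
  have diff: "V x \<noteq> V y \<and> tukey_incomparable (V x) (V y)" if "x \<noteq> y" for x y
  proof -
    have "y \<in> underS ?k x \<or> x \<in> underS ?k y"
      using Well_order_cases[OF wo, of x y] that by (auto simp: underS_def Field_card_of)
    then show ?thesis using V[of x] V[of y] unfolding P_def tukey_incomparable_def by metis
  qed
  then have "inj V" by (intro injI) blast
  then have "?k =o |range V|" by (intro card_of_ordIsoI[of V]) (simp add: bij_betw_def)
  then have "|range V| =o ctwo ^c continuum"
    unfolding ctwo_cexp_continuum by (rule ordIso_symmetric)
  moreover have "\<forall>X\<in>range V. good X" using V unfolding P_def by blast
  moreover have "pairwise tukey_incomparable (range V)"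
    unfolding pairwise_def using diff by (metis imageE)
  ultimately show ?thesis by blast
qed

end

theorem theorem44:
  shows "(cov_meager =o continuum \<longrightarrow>
            (\<exists>S. |S| =o ctwo ^c continuum \<and>
                 (\<forall>U\<in>S. selective_ultrafilter U) \<and>
                 pairwise tukey_incomparable S))
       \<and> (dominating_number =o continuum \<and> ultrafilter_number =o continuum \<longrightarrow>
            (\<exists>S. |S| =o ctwo ^c continuum \<and>
                 (\<forall>U\<in>S. p_point U) \<and>
                 pairwise tukey_incomparable S))"
proof (intro conjI impI)
  assume cov: "cov_meager =o continuum"
  let ?Q = "\<lambda>f X. f constant_on X \<or> inj_on f X"
  interpret extendible_small_filters ?Q
  proof
    fix f :: "nat \<Rightarrow> nat" and X assume "?Q f X"
    \<comment> \<open>A one-to-one function has at most one point in each fibre, so selectivity is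
      an instance of the common scheme.\<close>
    moreover have "finite {x\<in>X. f x = n}" if "inj_on f X" for n
    proof (rule inj_on_finite[of f _ "{n}"])
      show "inj_on f {x\<in>X. f x = n}" using that by (rule inj_on_subset) blast
    qed auto
    ultimately show "f constant_on X \<or> (\<forall>n. finite {x\<in>X. f x = n})" by blast
  qed (use cov small_filter_split_cov_meager small_filter_selective_set in blast)+
  have "selective_ultrafilter U" if "good U" for U
    using that unfolding good_def selective_ultrafilter_def by blast
  then show "\<exists>S. |S| =o ctwo ^c continuum \<and> (\<forall>U\<in>S. selective_ultrafilter U) \<and>
      pairwise tukey_incomparable S"
    using incomparable_family by blast
next
  assume du: "dominating_number =o continuum \<and> ultrafilter_number =o continuum"
  interpret extendible_small_filters
    "\<lambda>f X. f constant_on X \<or> (\<forall>n. finite {x\<in>X. f x = n})"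
    using du small_filter_split_ultrafilter_number small_filter_finite_to_one_set
    by unfold_locales blast+
  show "\<exists>S. |S| =o ctwo ^c continuum \<and> (\<forall>U\<in>S. p_point U) \<and> pairwise tukey_incomparable S"
    using incomparable_family good_p_point by blast
qed

end
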